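(* Let $\mathcal A$ be a nonzero real tensor of size $m\times n\times p$ with T-CSVD $\mathcal A=\mathcal U_{(r)}*\mathcal S_{(r)}*\mathcal V_{(r)}^H$, let $c_j^{(i)}$ ($1\le i\le p$, $1\le j\le r$) be the diagonal entries of the Fourier blocks of $\mathcal S_{(r)}$, let $\mathcal E=\mathcal U_{(r)}*\mathcal V_{(r)}^H$, let $\mathcal E_j^{(i)}$ be the associated partial isometry tensors, and let $\{\gamma_k^{(l)}\}$ be the set of distinct values among the $c_j^{(i)}$. For each $\gamma_k^{(l)}$ let $\Gamma_k^{(l)}$ be a simple closed positively oriented contour in $\mathbb C$ such that $\gamma_k^{(l)}$ is inside $\Gamma_k^{(l)}$ but no other $\gamma_{k'}^{(l')}$ is on or inside $\Gamma_k^{(l)}$, and put $\bar{\mathcal E}_k^{(l)}=\sum_{c_j^{(i)}=\gamma_k^{(l)}}\mathcal E_j^{(i)}$. Let $f:\mathbb C\to\mathbb C$ be a scalar function that is analytic on and inside every $\Gamma_k^{(l)}$ and, if some $c_j^{(i)}=0$, also satisfies $f(0)=0$. Then: (1) For every $k,l$, $$\bar{\mathcal E}_k^{(l)}=\mathcal E*\left(\frac1{2\pi \mathbf i}\int_{\Gamma_k^{(l)}}(z\mathcal E-\mathcal A)^\dagger\,dz\right)*\mathcal E .$$ (2) With $\Gamma=\bigcup_{k,l}\Gamma_k^{(l)}$ (so that $\int_\Gamma=\sum_{k,l}\int_{\Gamma_k^{(l)}}$), the generalized tensor function induced by $f$ satisfies $$f^{\Diamond}(\mathcal A)=\mathcal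 E*\left(\frac1{2\pi \mathbf i}\int_{\Gamma}f(z)(z\mathcal E-\mathcal A)^\dagger\,dz\right)*\mathcal E .$$ In particular, if all $c_j^{(i)}\ne0$ (and the contours are such that $1/z$ is analytic on and inside each of them), then $$\mathcal A^\dagger=\frac1{2\pi \mathbf i}\int_\Gamma\frac1z(z\mathcal E-\mathcal A)^\dagger\,dz .$$
   Context: T-product. For $\mathcal A\in\mathbb C^{m\times n\times p}$ with frontal slices $A^{(1)},\dots,A^{(p)}\in\mathbb C^{m\times n}$, $\mathrm{unfold}(\mathcal A)\in\mathbb C^{mp\times n}$ is the vertical stack of $A^{(1)},\dots,A^{(p)}$, $\mathrm{fold}$ is its inverse, and $\mathrm{bcirc}(\mathcal A)\in\mathbb C^{mp\times np}$ is the block circulant matrix whose $(a,b)$ block is $A^{(((a-b)\bmod p)+1)}$; $\mathrm{bcirc}^{-1}$ is the inverse of $\mathrm{bcirc}$ on its image. For $\mathcal B\in\mathbb C^{n\times s\times p}$, $\mathcal A*\mathcal B=\mathrm{fold}(\mathrm{bcirc}(\mathcal A)\,\mathrm{unfold}(\mathcal B))$. $\mathcal A^H$ is obtained by conjugate transposing each frontal slice and reversing the order of slices $2,\dots,p$; it satisfies $\mathrm{bcirc}(\mathcal A^H)=\mathrm{bcirc}(\mathcal A)^H$. The identity tensor has first frontal slice the identity matrix and other slices zero; $\mathcal Q$ is unitary if $\mathcal Q^H*\mathcal Q=\mathcal Q*\mathcal Q^H$ is the identity tensor. The Moore-Penrose inverse is $\mathcal A^\dagger=\mathrm{bcirc}^{-1}((\mathrm{bcirc}(\mathcal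 A))^\dagger)$. Integrals of tensor-valued functions are entrywise. T-SVD and generalized tensor function. $F_p=p^{-1/2}(\omega^{jk})_{j,k=0}^{p-1}$ with $\omega=e^{-2\pi\mathbf i/p}$. Every $\mathcal A\in\mathbb C^{m\times n\times p}$ has a T-SVD $\mathcal A=\mathcal U*\mathcal S*\mathcal V^H$ with $\mathcal U,\mathcal V$ unitary, $\mathcal S$ F-diagonal (every frontal slice diagonal), $\mathrm{bcirc}(\mathcal U)=(F_p\otimes I_m)\mathrm{diag}(U_1,\dots,U_p)(F_p^H\otimes I_m)$, $\mathrm{bcirc}(\mathcal S)=(F_p\otimes I_m)\mathrm{diag}(\Sigma_1,\dots,\Sigma_p)(F_p^H\otimes I_n)$, $\mathrm{bcirc}(\mathcal V)=(F_p\otimes I_n)\mathrm{diag}(V_1,\dots,V_p)(F_p^H\otimes I_n)$, where $U_i,V_i$ are unitary matrices and $\Sigma_i\in\mathbb R^{m\times n}$ is diagonal with nonnegative nonincreasing diagonal entries (so $U_i\Sigma_iV_i^H$ is an SVD of the $i$-th Fourier block of $\mathcal A$). For a scalar function $f$, $f^{\Diamond}(\mathcal A)=\mathcal U*\hat f(\mathcal S)*\mathcal V^H$ with $\hat f(\mathcal S)=\mathrm{bcirc}^{-1}\big((F_p\otimes I_m)\mathrm{diag}(\tilde f(\Sigma_1),\dots,\tilde f(\Sigma_p))(F_p^H\otimes I_n)\big)$ and $\tilde f(\Sigma_i)=f(\sqrt{\Sigma_i\Sigma_i^H})(\sqrt{\Sigma_i\Sigma_i^H})^\dagger\Sigma_i$,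 i.e. $\tilde f(\Sigma_i)$ is diagonal, with $f(\sigma)$ in place of each diagonal entry $\sigma>0$ and $0$ in place of each diagonal entry $0$. T-CSVD. Let $r_i=\mathrm{rank}\,\Sigma_i$ and $r=\max_i r_i$ (the tubal rank). Write $u_j^{(i)},v_j^{(i)}$ for the $j$-th columns of $U_i,V_i$ and $c_j^{(i)}$ for the $j$-th diagonal entry of $\Sigma_i$. The T-CSVD $\mathcal A=\mathcal U_{(r)}*\mathcal S_{(r)}*\mathcal V_{(r)}^H$ has Fourier blocks $(U_i)_r=(u_1^{(i)},\dots,u_r^{(i)})$, $(\Sigma_i)_r=\mathrm{diag}(c_1^{(i)},\dots,c_r^{(i)})$, $(V_i)_r=(v_1^{(i)},\dots,v_r^{(i)})$; some $c_j^{(i)}$ may be zero. The tensors $\mathcal E_j^{(i)}\in\mathbb C^{m\times n\times p}$ are defined by $\mathrm{bcirc}(\mathcal E_j^{(i)})=(F_p\otimes I_m)D(F_p^H\otimes I_n)$, where $D$ is the $p\times p$ block diagonal matrix whose $i$-th diagonal block is $u_j^{(i)}v_j^{(i)H}$ and whose other blocks are zero. Then $\mathcal E=\sum_{i,j}\mathcal E_j^{(i)}$ and $\mathcal A=\sum_{i,j}c_j^{(i)}\mathcal E_j^{(i)}$. *)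

theory Defs
  imports
    "HOL-Complex_Analysis.Complex_Analysis"
    "Jordan_Normal_Form.DL_Rank"
    "Jordan_Normal_Form.Schur_Decomposition"
begin

section \<open>Third-order tensors and the T-product\<close>

text \<open>
  A tensor of size \<open>m \<times> n \<times> p\<close> is the list of its \<open>p\<close> frontal slices. All indices (rows,
  columns, slices, Fourier blocks) start at 0. The sizes are read off the list; this is meaningful
  for \<open>p > 0\<close>.
\<close>

type_synonym tensor = "complex mat list"

definition blocks :: "nat \<Rightarrow> nat \<Rightarrow> nat \<Rightarrow> 'a mat list set" where
  "blocks m n p = {A. length A = p \<and> set A \<subseteq> carrier_mat m n}"

definition tensors :: "nat \<Rightarrow> nat \<Rightarrow> nat \<Rightarrow> tensor set" where
  "tensors m n p = blocks m n p"

definition trows :: "tensor \<Rightarrow> nat" where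
  "trows A = dim_row (hd A)"

definition tcols :: "tensor \<Rightarrow> nat" where
  "tcols A = dim_col (hd A)"

definition tentry :: "tensor \<Rightarrow> nat \<Rightarrow> nat \<Rightarrow> nat \<Rightarrow> complex" where
  "tentry A k a b = (A ! k) $$ (a, b)"

text \<open>In \<open>mk_tensor m n p g\<close> the entry in slice \<open>k\<close>, row \<open>a\<close>, column \<open>b\<close> is \<open>g k a b\<close>.\<close>

definition mk_tensor :: "nat \<Rightarrow> nat \<Rightarrow> nat \<Rightarrow> (nat \<Rightarrow> nat \<Rightarrow> nat \<Rightarrow> complex) \<Rightarrow> tensor" where
  "mk_tensor m n p g = map (\<lambda>k. Matrix.mat m n (\<lambda>(a, b). g k a b)) [0..<p]"

definition tzero :: "nat \<Rightarrow> nat \<Rightarrow> nat \<Rightarrow> tensor" where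
  "tzero m n p = replicate p (0\<^sub>m m n)"

definition real_tensor :: "tensor \<Rightarrow> bool" where
  "real_tensor A \<longleftrightarrow> (\<forall>X \<in> set A. elements_mat X \<subseteq> \<real>)"

definition tminus :: "tensor \<Rightarrow> tensor \<Rightarrow> tensor" (infixl "-\<^sub>t" 65) where
  "A -\<^sub>t B = map2 (-) A B"

definition tsmult :: "complex \<Rightarrow> tensor \<Rightarrow> tensor" (infixl "\<cdot>\<^sub>t" 70) where
  "c \<cdot>\<^sub>t A = map (\<lambda>X. c \<cdot>\<^sub>m X) A"

definition tsum :: "nat \<Rightarrow> nat \<Rightarrow> nat \<Rightarrow> ('i \<Rightarrow> tensor) \<Rightarrow> 'i set \<Rightarrow> tensor" where
  "tsum m n p F I = mk_tensor m n p (\<lambda>k a b. \<Sum>i\<in>I. tentry (F i) k a b)"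

definition tunfold :: "tensor \<Rightarrow> complex mat" where
  "tunfold A = Matrix.mat (trows A * length A) (tcols A)
     (\<lambda>(i, j). (A ! (i div trows A)) $$ (i mod trows A, j))"

definition tfold :: "nat \<Rightarrow> nat \<Rightarrow> complex mat \<Rightarrow> tensor" where
  "tfold m p M = mk_tensor m (dim_col M) p (\<lambda>k a b. M $$ (k * m + a, b))"

definition bcirc :: "tensor \<Rightarrow> complex mat" where
  "bcirc A = (let m = trows A; n = tcols A; p = length A in
     Matrix.mat (m * p) (n * p)
       (\<lambda>(i, j). (A ! nat ((int (i div m) - int (j div n)) mod int p)) $$ (i mod m, j mod n)))"

definition bcirc_inv :: "nat \<Rightarrow> nat \<Rightarrow> nat \<Rightarrow> complex mat \<Rightarrow> tensor" where
  "bcirc_inv m n p = the_inv_into (tensors m n p) bcirc"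

definition tprod :: "tensor \<Rightarrow> tensor \<Rightarrow> tensor" (infixl "*\<^sub>t" 70) where
  "A *\<^sub>t B = tfold (trows A) (length A) (bcirc A * tunfold B)"

definition tadjoint :: "tensor \<Rightarrow> tensor" where
  "tadjoint A = map (\<lambda>k. mat_adjoint (A ! ((length A - k) mod length A))) [0..<length A]"

definition tid :: "nat \<Rightarrow> nat \<Rightarrow> tensor" where
  "tid n p = map (\<lambda>k. if k = 0 then 1\<^sub>m n else 0\<^sub>m n n) [0..<p]"

definition t_unitary :: "nat \<Rightarrow> nat \<Rightarrow> tensor \<Rightarrow> bool" where
  "t_unitary n p Q \<longleftrightarrow> Q \<in> tensors n n p \<and>
     tadjoint Q *\<^sub>t Q = tid n p \<and> Q *\<^sub>t tadjoint Q = tid n p"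

definition F_diagonal :: "tensor \<Rightarrow> bool" where
  "F_diagonal S \<longleftrightarrow> (\<forall>X \<in> set S. diagonal_mat X)"

section \<open>Moore--Penrose inverse\<close>

text \<open>The unique solution of the four Penrose equations.\<close>

definition mat_pinv :: "complex mat \<Rightarrow> complex mat" where
  "mat_pinv A = (THE X. X \<in> carrier_mat (dim_col A) (dim_row A) \<and>
     A * X * A = A \<and> X * A * X = X \<and>
     mat_adjoint (A * X) = A * X \<and> mat_adjoint (X * A) = X * A)"

definition tpinv :: "tensor \<Rightarrow> tensor" where
  "tpinv A = bcirc_inv (tcols A) (trows A) (length A) (mat_pinv (bcirc A))"

section \<open>Fourier blocks, T-SVD and generalized tensor functions\<close>

definition fourier_mat :: "nat \<Rightarrow> complex mat" where
  "fourier_mat p = Matrix.mat p p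
     (\<lambda>(j, k). exp (- (2 * of_real pi * \<i>) / of_nat p) ^ (j * k) / of_real (sqrt (real p)))"

definition kron :: "complex mat \<Rightarrow> complex mat \<Rightarrow> complex mat" where
  "kron A B = Matrix.mat (dim_row A * dim_row B) (dim_col A * dim_col B)
     (\<lambda>(i, j). A $$ (i div dim_row B, j div dim_col B) * B $$ (i mod dim_row B, j mod dim_col B))"

text \<open>The matrix \<open>(F\<^sub>p \<otimes> I\<^sub>m) diag(D\<^sub>1, \<dots>, D\<^sub>p) (F\<^sub>p\<^sup>H \<otimes> I\<^sub>n)\<close> for blocks \<open>D\<^sub>i\<close> of size \<open>m \<times> n\<close>.\<close>

definition from_fourier :: "nat \<Rightarrow> nat \<Rightarrow> complex mat list \<Rightarrow> complex mat" where
  "from_fourier m n Ds = kron (fourier_mat (length Ds)) (1\<^sub>m m) * diag_block_mat Ds *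
     kron (mat_adjoint (fourier_mat (length Ds))) (1\<^sub>m n)"

definition mat_unitary :: "nat \<Rightarrow> complex mat \<Rightarrow> bool" where
  "mat_unitary n Q \<longleftrightarrow> Q \<in> carrier_mat n n \<and>
     mat_adjoint Q * Q = 1\<^sub>m n \<and> Q * mat_adjoint Q = 1\<^sub>m n"

definition sv_mat :: "nat \<Rightarrow> nat \<Rightarrow> real mat \<Rightarrow> bool" where
  "sv_mat m n D \<longleftrightarrow> D \<in> carrier_mat m n \<and> diagonal_mat D \<and>
     (\<forall>j < min m n. 0 \<le> D $$ (j, j)) \<and>
     (\<forall>j k. j \<le> k \<and> k < min m n \<longrightarrow> D $$ (k, k) \<le> D $$ (j, j))"

text \<open>
  A T-SVD consists of the tensors \<open>U\<close>, \<open>S\<close>, \<open>V\<close> together with their Fourier blocks, the entries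
  of the lists \<open>Us\<close>, \<open>Ss\<close>, \<open>Vs\<close>.
\<close>

definition is_tsvd :: "nat \<Rightarrow> nat \<Rightarrow> nat \<Rightarrow> tensor \<Rightarrow> tensor \<Rightarrow> tensor \<Rightarrow> tensor \<Rightarrow>
    complex mat list \<Rightarrow> real mat list \<Rightarrow> complex mat list \<Rightarrow> bool" where
  "is_tsvd m n p A U S V Us Ss Vs \<longleftrightarrow>
     A \<in> tensors m n p \<and> S \<in> tensors m n p \<and>
     t_unitary m p U \<and> t_unitary n p V \<and> F_diagonal S \<and>
     A = U *\<^sub>t S *\<^sub>t tadjoint V \<and>
     length Us = p \<and> length Ss = p \<and> length Vs = p \<and>
     (\<forall>X \<in> set Us. mat_unitary m X) \<and> (\<forall>D \<in> set Ss. sv_mat m n D) \<and>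
     (\<forall>X \<in> set Vs. mat_unitary n X) \<and>
     bcirc U = from_fourier m m Us \<and>
     bcirc S = from_fourier m n (map (map_mat complex_of_real) Ss) \<and>
     bcirc V = from_fourier n n Vs"

definition ftilde :: "(complex \<Rightarrow> complex) \<Rightarrow> real mat \<Rightarrow> complex mat" where
  "ftilde f D = Matrix.mat (dim_row D) (dim_col D)
     (\<lambda>(i, j). if i = j \<and> D $$ (i, j) > 0 then f (complex_of_real (D $$ (i, j))) else 0)"

definition fhat :: "nat \<Rightarrow> nat \<Rightarrow> (complex \<Rightarrow> complex) \<Rightarrow> real mat list \<Rightarrow> tensor" where
  "fhat m n f Ss = bcirc_inv m n (length Ss) (from_fourier m n (map (ftilde f) Ss))"

text \<open>
  The value \<open>U * fhat(S) * V\<^sup>H\<close> does not depend on the chosen T-SVD, hence the definite description.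
\<close>

definition gen_tensor_fun :: "(complex \<Rightarrow> complex) \<Rightarrow> tensor \<Rightarrow> tensor" where
  "gen_tensor_fun f A = (let m = trows A; n = tcols A; p = length A in
     THE B. \<exists>U S V Us Ss Vs. is_tsvd m n p A U S V Us Ss Vs \<and>
       B = U *\<^sub>t fhat m n f Ss *\<^sub>t tadjoint V)"

section \<open>T-CSVD and the associated partial isometry tensors\<close>

definition tubal_rank :: "nat \<Rightarrow> real mat list \<Rightarrow> nat" where
  "tubal_rank m Ss = Max (vec_space.rank m ` set Ss)"

definition first_cols :: "nat \<Rightarrow> 'a mat \<Rightarrow> 'a mat" where
  "first_cols r X = mat_of_cols (dim_row X) (take r (cols X))"

definition leading_diag :: "nat \<Rightarrow> real mat \<Rightarrow> complex mat" where
  "leading_diag r D = mat_diag r (\<lambda>j. complex_of_real (D $$ (j, j)))"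

definition is_tcsvd :: "nat \<Rightarrow> nat \<Rightarrow> nat \<Rightarrow> tensor \<Rightarrow> nat \<Rightarrow> tensor \<Rightarrow> tensor \<Rightarrow> tensor \<Rightarrow>
    complex mat list \<Rightarrow> real mat list \<Rightarrow> complex mat list \<Rightarrow> bool" where
  "is_tcsvd m n p A r Ur Sr Vr Us Ss Vs \<longleftrightarrow>
     (\<exists>U S V. is_tsvd m n p A U S V Us Ss Vs) \<and>
     r = tubal_rank m Ss \<and>
     Ur \<in> tensors m r p \<and> Sr \<in> tensors r r p \<and> Vr \<in> tensors n r p \<and>
     bcirc Ur = from_fourier m r (map (first_cols r) Us) \<and>
     bcirc Sr = from_fourier r r (map (leading_diag r) Ss) \<and>
     bcirc Vr = from_fourier n r (map (first_cols r) Vs) \<and>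
     A = Ur *\<^sub>t Sr *\<^sub>t tadjoint Vr"

definition csv :: "real mat list \<Rightarrow> nat \<Rightarrow> nat \<Rightarrow> real" where
  "csv Ss i j = (Ss ! i) $$ (j, j)"

definition csv_set :: "nat \<Rightarrow> real mat list \<Rightarrow> real set" where
  "csv_set r Ss = {csv Ss i j | i j. i < length Ss \<and> j < r}"

definition outer_prod :: "complex Matrix.vec \<Rightarrow> complex Matrix.vec \<Rightarrow> complex mat" where
  "outer_prod u v = mat_of_cols (dim_vec u) [u] * mat_adjoint (mat_of_cols (dim_vec v) [v])"

definition iso_tensor :: "nat \<Rightarrow> nat \<Rightarrow> complex mat list \<Rightarrow> complex mat list \<Rightarrow> nat \<Rightarrow> nat \<Rightarrow> tensor"
  where
  "iso_tensor m n Us Vs i j = bcirc_inv m n (length Us) (from_fourier m n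
     (map (\<lambda>k. if k = i then outer_prod (col (Us ! i) j) (col (Vs ! i) j) else 0\<^sub>m m n)
        [0..<length Us]))"

definition iso_tensor_at ::
    "nat \<Rightarrow> nat \<Rightarrow> nat \<Rightarrow> complex mat list \<Rightarrow> real mat list \<Rightarrow> complex mat list \<Rightarrow> real \<Rightarrow> tensor"
  where
  "iso_tensor_at m n r Us Ss Vs \<gamma> = tsum m n (length Us) (\<lambda>(i, j). iso_tensor m n Us Vs i j)
     {(i, j). i < length Us \<and> j < r \<and> csv Ss i j = \<gamma>}"

section \<open>Contours and entrywise contour integrals\<close>

definition pos_simple_closed_contour :: "(real \<Rightarrow> complex) \<Rightarrow> bool" where
  "pos_simple_closed_contour g \<longleftrightarrow> valid_path g \<and> simple_path g \<and> pathfinish g = pathstart g \<and>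
     (\<forall>w \<in> inside (path_image g). winding_number g w = 1)"

definition on_and_inside :: "(real \<Rightarrow> complex) \<Rightarrow> complex set" where
  "on_and_inside g = path_image g \<union> inside (path_image g)"

definition t_contour_integrable ::
    "nat \<Rightarrow> nat \<Rightarrow> nat \<Rightarrow> (complex \<Rightarrow> tensor) \<Rightarrow> (real \<Rightarrow> complex) \<Rightarrow> bool" where
  "t_contour_integrable m n p F g \<longleftrightarrow>
     (\<forall>k<p. \<forall>a<m. \<forall>b<n. (\<lambda>z. tentry (F z) k a b) contour_integrable_on g)"

definition t_contour_integral ::
    "nat \<Rightarrow> nat \<Rightarrow> nat \<Rightarrow> (real \<Rightarrow> complex) \<Rightarrow> (complex \<Rightarrow> tensor) \<Rightarrow> tensor" where
  "t_contour_integral m n p g F =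
     mk_tensor m n p (\<lambda>k a b. contour_integral g (\<lambda>z. tentry (F z) k a b))"

text \<open>The integral over a finite family of contours \<open>G \<gamma>\<close>, \<open>\<gamma> \<in> I\<close>, is the sum of the integrals.\<close>

definition t_contour_integral_family ::
    "nat \<Rightarrow> nat \<Rightarrow> nat \<Rightarrow> ('i \<Rightarrow> real \<Rightarrow> complex) \<Rightarrow> 'i set \<Rightarrow> (complex \<Rightarrow> tensor) \<Rightarrow> tensor" where
  "t_contour_integral_family m n p G I F = tsum m n p (\<lambda>\<gamma>. t_contour_integral m n p (G \<gamma>) F) I"

end

(*
Conjugation with the discrete Fourier matrix turns the T-product into the blockwise matrix product,
so everything reduces to the p Fourier blocks. In terms of the singular vectors the i-th blocks of
A and E are sum_j c_j u_j v_j^H and sum_j u_j v_j^H (j < r), hence the block of (z E - A)^+ is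
sum_j (z - c_j)^(-1) v_j u_j^H, and multiplying by E on both sides exchanges the roles of u_j and
v_j. The contour integrals then reduce to Cauchy's integral formula for f(z) / (z - c_j).
*)
theory Submission
  imports Defs
begin

section \<open>Block matrices and characters\<close>

text \<open>Two points shape the argument. The first is that \<open>gen_tensor_fun\<close> is a
  definite description, so its value is known only after all T-SVDs of \<open>A\<close> have been
  shown to yield the same tensor, although singular vectors belonging to repeated values may be
  rotated. The second is the value 0: \<open>r\<close> is the largest rank among the blocks, so a
  block of smaller rank contributes terms u_j v_j^H with c_j = 0, which \<open>E\<close> contains
  and \<open>A\<close> does not see. On such terms the generalized function gives 0 while the
  contour integral gives f(0), which is what the condition f(0) = 0 reconciles. At a point z = c_j
  the formula for the Moore-Penrose inverse persists because \<open>inverse 0 = 0\<close>. The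
  Fourier calculus is done on entries, from the orthogonality of the characters of Z/p.\<close>

lemma sum_blocks:
  fixes g :: "nat \<Rightarrow> 'a::comm_monoid_add"
  shows "(\<Sum>x<q * s. g x) = (\<Sum>k<q. \<Sum>c<s. g (k * s + c))"
proof -
  have "(\<Sum>x<q * s. g x) = (\<Sum>k<q. sum g {k * s..<k * s + s})"
    by (rule sum.nat_group [symmetric])
  also have "\<dots> = (\<Sum>k<q. \<Sum>c<s. g (k * s + c))"
  proof (rule sum.cong [OF refl])
    fix k
    show "sum g {k * s..<k * s + s} = (\<Sum>c<s. g (k * s + c))"
      by (rule sum.reindex_bij_witness [of _ "\<lambda>c. k * s + c" "\<lambda>x. x - k * s"]) auto
  qed
  finally show ?thesis .
qed

lemma block_index_less:
  fixes k a p m :: nat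
  assumes "k < p" "a < m"
  shows "k * m + a < p * m" "k * m + a < m * p"
proof -
  have "k * m + a < Suc k * m" using assms by simp
  also have "\<dots> \<le> p * m" using assms by (intro mult_right_mono) auto
  finally show "k * m + a < p * m" .
  then show "k * m + a < m * p" by (simp add: mult.commute)
qed

lemma block_index_cases:
  fixes x p m :: nat
  assumes "x < p * m"
  obtains k a where "k < p" "a < m" "x = k * m + a"
proof
  have "m > 0" using assms by (cases m) auto
  then show "x mod m < m" by simp
  show "x div m < p" using assms by (simp add: less_mult_imp_div_less)
  show "x = x div m * m + x mod m" by simp
qed

text \<open>The form \<open>k * m + a\<close> with \<open>a < m\<close> reaches every index below
  \<open>p * m\<close>. Comparing entries in this form keeps \<open>div\<close> and
  \<open>mod\<close> by the block size out of the Fourier sums.\<close>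

lemma eq_block_matI:
  fixes M N :: "'a mat"
  assumes "M \<in> carrier_mat (p * m) (q * n)" "N \<in> carrier_mat (p * m) (q * n)"
    and "\<And>k l a b. k < p \<Longrightarrow> l < q \<Longrightarrow> a < m \<Longrightarrow> b < n \<Longrightarrow>
      M $$ (k * m + a, l * n + b) = N $$ (k * m + a, l * n + b)"
  shows "M = N"
proof (rule eq_matI)
  fix i j assume "i < dim_row N" "j < dim_col N"
  then have "i < p * m" "j < q * n" using assms by auto
  then show "M $$ (i, j) = N $$ (i, j)"
    by (elim block_index_cases) (auto simp: assms(3))
qed (use assms in auto)

lemma mult_mat_index:
  assumes "A \<in> carrier_mat m q" "B \<in> carrier_mat q n" "i < m" "j < n"
  shows "(A * B) $$ (i, j) = (\<Sum>k<q. A $$ (i, k) * B $$ (k, j))"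
  using assms by (auto simp: scalar_prod_def atLeast0LessThan intro!: sum.cong)

lemma mult_block_mat_index:
  fixes A B :: "'a::semiring_0 mat"
  assumes "A \<in> carrier_mat m (q * s)" "B \<in> carrier_mat (q * s) n" "i < m" "j < n"
  shows "(A * B) $$ (i, j) = (\<Sum>k<q. \<Sum>c<s. A $$ (i, k * s + c) * B $$ (k * s + c, j))"
  using mult_mat_index [OF assms] by (simp add: sum_blocks)

section \<open>Entries of adjoints, Kronecker products and block diagonal matrices\<close>

lemma mat_adjoint_carrier [simp]:
  "A \<in> carrier_mat m n \<Longrightarrow> mat_adjoint A \<in> carrier_mat n m"
  by (auto simp: mat_adjoint_def)

lemma dim_mat_adjoint [simp]:
  "dim_row (mat_adjoint A) = dim_col A" "dim_col (mat_adjoint A) = dim_row A"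
  by (auto simp: mat_adjoint_def)

lemma mat_adjoint_index [simp]:
  fixes A :: "complex mat"
  shows "i < dim_col A \<Longrightarrow> j < dim_row A \<Longrightarrow> mat_adjoint A $$ (i, j) = cnj (A $$ (j, i))"
  by (simp add: mat_adjoint_def mat_of_rows_def)

lemma mat_adjoint_mult:
  fixes A B :: "complex mat"
  assumes "A \<in> carrier_mat m q" "B \<in> carrier_mat q n"
  shows "mat_adjoint (A * B) = mat_adjoint B * mat_adjoint A"
  using assms
  by (intro eq_matI) (auto simp: scalar_prod_def mult.commute intro!: sum.cong)

lemma kron_carrier:
  "A \<in> carrier_mat p q \<Longrightarrow> B \<in> carrier_mat m n \<Longrightarrow> kron A B \<in> carrier_mat (p * m) (q * n)"
  by (auto simp: kron_def)

lemma kron_index: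
  assumes "A \<in> carrier_mat p q" "B \<in> carrier_mat m n" "k < p" "l < q" "a < m" "b < n"
  shows "kron A B $$ (k * m + a, l * n + b) = A $$ (k, l) * B $$ (a, b)"
  using assms block_index_less by (auto simp: kron_def)

lemma diag_block_mat_carrier:
  assumes "\<And>i. i < p \<Longrightarrow> D i \<in> carrier_mat m n"
  shows "diag_block_mat (map D [0..<p]) \<in> carrier_mat (p * m) (p * n)"
  using assms
proof (induction p)
  case (Suc p)
  then have "D p \<in> carrier_mat m n"
    "diag_block_mat (map D [0..<p]) \<in> carrier_mat (p * m) (p * n)" by auto
  then show ?case by (auto simp: diag_block_mat_last Let_def)
qed auto

lemma diag_block_mat_index:
  assumes "\<And>i. i < p \<Longrightarrow> D i \<in> carrier_mat m n" "k < p" "l < p" "a < m" "b < n"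
  shows "diag_block_mat (map D [0..<p]) $$ (k * m + a, l * n + b) =
    (if k = l then D k $$ (a, b) else 0)"
  using assms
proof (induction p)
  case (Suc p)
  have C: "diag_block_mat (map D [0..<p]) \<in> carrier_mat (p * m) (p * n)"
    using Suc.prems by (intro diag_block_mat_carrier) auto
  have Dp: "D p \<in> carrier_mat m n" using Suc.prems by auto
  \<comment> \<open>The induction splits off the last block, because \<open>[0..<Suc p]\<close>
    grows at its end; these equivalences decide on which side of the cut a row or column
    lies.\<close>
  have less: "k * m + a < p * m \<longleftrightarrow> k < p" "l * n + b < p * n \<longleftrightarrow> l < p"
    using Suc.prems block_index_less by (auto simp: less_Suc_eq)
  have bound: "k * m + a < p * m + m" "l * n + b < p * n + n"
    using Suc.prems block_index_less(1) [of k "Suc p" a m] block_index_less(1) [of l "Suc p" b n] by auto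
  have IH: "k < p \<Longrightarrow> l < p \<Longrightarrow> diag_block_mat (map D [0..<p]) $$ (k * m + a, l * n + b) =
    (if k = l then D k $$ (a, b) else 0)"
    using Suc by auto
  consider "k < p" "l < p" | "k < p" "l = p" | "k = p" "l < p" | "k = p" "l = p"
    using Suc.prems by linarith
  then show ?case
    using C Dp less bound IH Suc.prems(4,5)
    by cases (auto simp: diag_block_mat_last Let_def)
qed simp

text \<open>The additive character k |-> omega^k with omega = exp (-2 pi i / p). Integer arguments
  allow differences of slice indices and turn conjugation into negation.\<close>

definition dft_char :: "nat \<Rightarrow> int \<Rightarrow> complex" where
  "dft_char p k = cis (- 2 * pi * of_int k / of_nat p)"

lemma dft_char_0 [simp]: "dft_char p 0 = 1"
  by (simp add: dft_char_def)

lemma dft_char_add: "dft_char p (k + l) = dft_char p k * dft_char p l"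
  by (simp add: dft_char_def cis_mult add_divide_distrib diff_divide_distrib algebra_simps)

lemma cnj_dft_char: "cnj (dft_char p k) = dft_char p (- k)"
  by (simp add: dft_char_def cis_cnj)

lemma dft_char_power: "dft_char p k ^ j = dft_char p (k * int j)"
  by (simp add: dft_char_def Complex.DeMoivre algebra_simps)

lemma dft_char_eq_1_iff:
  assumes p: "p > 0"
  shows "dft_char p k = 1 \<longleftrightarrow> int p dvd k"
proof -
  have "dft_char p k = 1 \<longleftrightarrow> (\<exists>j::int. - 2 * pi * of_int k / of_nat p = of_int (2 * j) * pi)"
    by (simp add: dft_char_def cis_conv_exp exp_eq_1)
  also have "\<dots> \<longleftrightarrow> (\<exists>j::int. k = int p * j)"
  proof -
    \<comment> \<open>The minus sign in the exponent of omega makes the witness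
      \<open>- j\<close>.\<close>
    have "- 2 * pi * of_int k / of_nat p = of_int (2 * j) * pi \<longleftrightarrow> k = int p * (- j)" for j
    proof -
      have "- 2 * pi * of_int k / of_nat p = of_int (2 * j) * pi \<longleftrightarrow>
          pi * of_int k = pi * (of_nat p * - of_int j)"
        using p by (auto simp: field_simps)
      also have "\<dots> \<longleftrightarrow> (of_int k :: real) = of_nat p * - of_int j"
        by (simp only: mult_cancel_left pi_neq_zero simp_thms)
      also have "\<dots> \<longleftrightarrow> (of_int k :: real) = of_int (int p * (- j))" by simp
      finally show ?thesis unfolding of_int_eq_iff .
    qed
    then show ?thesis by (metis minus_minus)
  qed
  finally show ?thesis by (simp add: dvd_def)
qed

lemma dft_char_mult_period: "p > 0 \<Longrightarrow> dft_char p (int p * k) = 1"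
  by (simp add: dft_char_eq_1_iff)

text \<open>The slice index in \<open>bcirc\<close> is reduced mod p; since omega^p = 1, the
  reduction is invisible to the character, also after multiplication by a block number
  \<open>l\<close>.\<close>

lemma dft_char_mod: "p > 0 \<Longrightarrow> dft_char p ((k mod int p) * l) = dft_char p (k * l)"
proof -
  assume p: "p > 0"
  have "dft_char p (k * l) = dft_char p ((k mod int p) * l + int p * ((k div int p) * l))"
    by (metis mult.assoc mod_mult_div_eq distrib_right)
  then show ?thesis by (simp add: dft_char_add dft_char_mult_period [OF p])
qed

text \<open>Orthogonality of characters: the sum is a geometric series with ratio omega^k, which is
  either constantly 1 or has the vanishing numerator (omega^k)^p - 1.\<close>

lemma sum_dft_char:
  assumes p: "p > 0"
  shows "(\<Sum>l<p. dft_char p (k * int l)) = (if int p dvd k then of_nat p else 0)"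
proof (cases "int p dvd k")
  case True
  then have "dft_char p (k * int l) = 1" for l
    by (simp add: dft_char_eq_1_iff [OF p])
  then show ?thesis using True by simp
next
  case False
  then have ne: "dft_char p k \<noteq> 1" by (simp add: dft_char_eq_1_iff [OF p])
  have "(\<Sum>l<p. dft_char p (k * int l)) = (\<Sum>l<p. dft_char p k ^ l)"
    by (simp add: dft_char_power)
  also have "\<dots> = (dft_char p k ^ p - 1) / (dft_char p k - 1)"
    by (rule geometric_sum [OF ne])
  also have "dft_char p k ^ p = 1"
    using dft_char_mult_period [OF p, of k] by (simp add: dft_char_power mult.commute)
  finally show ?thesis using False by simp
qed

lemma sum_dft_char_diff:
  assumes p: "p > 0" and "i < p" "j < p"
  shows "(\<Sum>l<p. dft_char p ((int i - int j) * int l)) = (if i = j then of_nat p else 0)"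
proof -
  have "int p dvd int i - int j \<longleftrightarrow> i = j"
  proof
    assume "int p dvd int i - int j"
    then have "int i mod int p = int j mod int p" by (simp add: mod_eq_dvd_iff)
    then show "i = j" using assms by simp
  qed simp
  then show ?thesis by (simp add: sum_dft_char [OF p])
qed

lemma fourier_mat_carrier [simp]: "fourier_mat p \<in> carrier_mat p p"
  by (simp add: fourier_mat_def)

lemma fourier_mat_index:
  assumes "j < p" "k < p"
  shows "fourier_mat p $$ (j, k) = dft_char p (int j * int k) / of_real (sqrt (real p))"
proof -
  have "exp (- (2 * of_real pi * \<i>) / of_nat p) = dft_char p 1"
    by (simp add: dft_char_def cis_conv_exp mult.commute mult.left_commute)
  then show ?thesis using assms by (simp add: fourier_mat_def dft_char_power)
qed

section \<open>Block diagonalization by the Fourier matrix\<close>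

lemma adjoint_fourier_mat_index:
  assumes "j < p" "k < p"
  shows "mat_adjoint (fourier_mat p) $$ (j, k) = dft_char p (- (int k * int j)) / of_real (sqrt (real p))"
  using assms carrier_matD [OF fourier_mat_carrier [of p]]
  by (simp add: fourier_mat_index cnj_dft_char)

lemma from_fourier_carrier:
  assumes "\<And>i. i < p \<Longrightarrow> D i \<in> carrier_mat m n"
  shows "from_fourier m n (map D [0..<p]) \<in> carrier_mat (p * m) (p * n)"
proof -
  have "kron (fourier_mat p) (1\<^sub>m m) \<in> carrier_mat (p * m) (p * m)"
    "kron (mat_adjoint (fourier_mat p)) (1\<^sub>m n) \<in> carrier_mat (p * n) (p * n)"
    by (auto intro!: kron_carrier)
  then show ?thesis
    by (auto simp: from_fourier_def intro!: mult_carrier_mat diag_block_mat_carrier assms)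
qed

text \<open>Kronecker factors with an identity act only on block indices, so each block is a Fourier
  sum of the \<open>D i\<close>. It depends on k - l modulo p alone, which is why the matrix is
  block circulant.\<close>

lemma from_fourier_index:
  assumes D: "\<And>i. i < p \<Longrightarrow> D i \<in> carrier_mat m n" and k: "k < p" and l: "l < p" and a: "a < m" and b: "b < n"
  shows "from_fourier m n (map D [0..<p]) $$ (k * m + a, l * n + b) =
    (\<Sum>i<p. dft_char p ((int k - int l) * int i) * D i $$ (a, b)) / of_nat p"
proof -
  let ?F = "kron (fourier_mat p) (1\<^sub>m m)" and ?G = "kron (mat_adjoint (fourier_mat p)) (1\<^sub>m n)"
  let ?D = "diag_block_mat (map D [0..<p])"
  have F: "?F \<in> carrier_mat (p * m) (p * m)" and G: "?G \<in> carrier_mat (p * n) (p * n)"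
    by (auto intro!: kron_carrier)
  have DD: "?D \<in> carrier_mat (p * m) (p * n)"
    by (intro diag_block_mat_carrier D)
  have FD: "(?F * ?D) $$ (k * m + a, i * n + c) = fourier_mat p $$ (k, i) * D i $$ (a, c)"
    if "i < p" "c < n" for i c
  proof -
    have "(?F * ?D) $$ (k * m + a, i * n + c) =
        (\<Sum>j<p. \<Sum>d<m. ?F $$ (k * m + a, j * m + d) * ?D $$ (j * m + d, i * n + c))"
      by (rule mult_block_mat_index [OF F DD]) (use that block_index_less k a in auto)
    \<comment> \<open>The identity factor forces \<open>d = a\<close>, the block diagonal forces
      \<open>j = i\<close>.\<close>
    also have "\<dots> = (\<Sum>j<p. \<Sum>d<m. (if d = a then if j = i then fourier_mat p $$ (k, i) * D i $$ (a, c) else 0 else 0))"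
      using that k a b
      by (intro sum.cong refl) (auto simp: kron_index [of _ p p _ m m] diag_block_mat_index [OF D])
    also have "\<dots> = fourier_mat p $$ (k, i) * D i $$ (a, c)"
      using that a by simp
    finally show ?thesis .
  qed
  have "from_fourier m n (map D [0..<p]) $$ (k * m + a, l * n + b) =
      (\<Sum>i<p. \<Sum>c<n. (?F * ?D) $$ (k * m + a, i * n + c) * ?G $$ (i * n + c, l * n + b))"
    unfolding from_fourier_def length_map length_upt diff_zero
    by (rule mult_block_mat_index [OF mult_carrier_mat [OF F DD] G])
      (use block_index_less k l a b in auto)
  also have "\<dots> = (\<Sum>i<p. \<Sum>c<n. (if c = b then
      fourier_mat p $$ (k, i) * mat_adjoint (fourier_mat p) $$ (i, l) * D i $$ (a, b) else 0))"
    using k l a b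
    by (intro sum.cong refl) (auto simp: FD kron_index [of _ p p _ n n])
  also have "\<dots> = (\<Sum>i<p. fourier_mat p $$ (k, i) * mat_adjoint (fourier_mat p) $$ (i, l) * D i $$ (a, b))"
    using b by simp
  also have "\<dots> = (\<Sum>i<p. dft_char p ((int k - int l) * int i) * D i $$ (a, b) / of_nat p)"
  proof (intro sum.cong refl)
    fix i assume "i \<in> {..<p}"
    then have i: "i < p" by simp
    \<comment> \<open>Each Fourier factor carries p^(-1/2); together they give the 1/p of the
      claim.\<close>
    have sq: "complex_of_real (sqrt (real p)) * complex_of_real (sqrt (real p)) = of_nat p"
      by (simp flip: of_real_mult)
    have "fourier_mat p $$ (k, i) * mat_adjoint (fourier_mat p) $$ (i, l) =
        (dft_char p (int k * int i) * dft_char p (- (int l * int i))) / of_nat p"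
      using i k l by (simp add: fourier_mat_index adjoint_fourier_mat_index sq)
    also have "\<dots> = dft_char p ((int k - int l) * int i) / of_nat p"
      by (simp flip: dft_char_add add: algebra_simps)
    finally show "fourier_mat p $$ (k, i) * mat_adjoint (fourier_mat p) $$ (i, l) * D i $$ (a, b) =
        dft_char p ((int k - int l) * int i) * D i $$ (a, b) / of_nat p"
      by simp
  qed
  finally show ?thesis by (simp add: sum_divide_distrib)
qed

text \<open>Summation over the middle block index \<open>x\<close> leaves the character sum over (j
  - i) x, equal to p for i = j and to 0 otherwise; this p cancels one of the two factors 1/p. It is
  the cancellation of F_p^H F_p in the middle, done on entries.\<close>

lemma from_fourier_mult:
  assumes D: "\<And>i. i < p \<Longrightarrow> D i \<in> carrier_mat m q" and G: "\<And>i. i < p \<Longrightarrow> G i \<in> carrier_mat q n"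
    and p: "p > 0"
  shows "from_fourier m q (map D [0..<p]) * from_fourier q n (map G [0..<p]) =
    from_fourier m n (map (\<lambda>i. D i * G i) [0..<p])"
proof (rule eq_block_matI [of _ p m p n])
  fix k l a b assume *: "k < p" "l < p" "a < m" "b < n"
  let ?c = "\<lambda>x. dft_char p x"
  have "(from_fourier m q (map D [0..<p]) * from_fourier q n (map G [0..<p])) $$ (k * m + a, l * n + b) =
      (\<Sum>x<p. \<Sum>c<q. from_fourier m q (map D [0..<p]) $$ (k * m + a, x * q + c) *
        from_fourier q n (map G [0..<p]) $$ (x * q + c, l * n + b))"
    by (rule mult_block_mat_index [OF from_fourier_carrier [OF D] from_fourier_carrier [OF G]])
      (use block_index_less * in auto)
  also have "\<dots> = (\<Sum>x<p. \<Sum>c<q. \<Sum>i<p. \<Sum>j<p.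
      (?c ((int k - int x) * int i) * D i $$ (a, c) / of_nat p) *
      (?c ((int x - int l) * int j) * G j $$ (c, b) / of_nat p))"
    using * by (intro sum.cong refl)
      (simp add: from_fourier_index [OF D] from_fourier_index [OF G] sum_divide_distrib sum_product)
  \<comment> \<open>The exponents are regrouped so that \<open>x\<close> occurs in a single
    character.\<close>
  also have "\<dots> = (\<Sum>x<p. \<Sum>c<q. \<Sum>i<p. \<Sum>j<p.
      ?c (int k * int i - int l * int j) * D i $$ (a, c) * G j $$ (c, b) / (of_nat p)\<^sup>2 *
      ?c ((int j - int i) * int x))"
  proof (intro sum.cong refl)
    fix x c i j
    have "?c ((int k - int x) * int i) * ?c ((int x - int l) * int j) =
        ?c (int k * int i - int l * int j) * ?c ((int j - int i) * int x)"
      by (simp flip: dft_char_add add: algebra_simps)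
    then show "?c ((int k - int x) * int i) * D i $$ (a, c) / of_nat p *
      (?c ((int x - int l) * int j) * G j $$ (c, b) / of_nat p) =
      ?c (int k * int i - int l * int j) * D i $$ (a, c) * G j $$ (c, b) / (of_nat p)\<^sup>2 *
      ?c ((int j - int i) * int x)"
      by (simp add: power2_eq_square field_simps)
  qed
  also have "\<dots> = (\<Sum>c<q. \<Sum>i<p. \<Sum>j<p. \<Sum>x<p.
      ?c (int k * int i - int l * int j) * D i $$ (a, c) * G j $$ (c, b) / (of_nat p)\<^sup>2 *
      ?c ((int j - int i) * int x))"
    by (rule trans [OF sum.swap], rule sum.cong [OF refl], rule trans [OF sum.swap],
        rule sum.cong [OF refl], rule sum.swap)
  also have "\<dots> = (\<Sum>c<q. \<Sum>i<p. \<Sum>j<p. (if j = i then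
      ?c (int k * int i - int l * int j) * D i $$ (a, c) * G j $$ (c, b) / of_nat p else 0))"
    using p by (intro sum.cong refl, subst sum_distrib_left [symmetric])
      (simp add: sum_dft_char_diff power2_eq_square)
  also have "\<dots> = (\<Sum>c<q. \<Sum>i<p. ?c ((int k - int l) * int i) * (D i $$ (a, c) * G i $$ (c, b)) / of_nat p)"
    by (simp add: sum.delta' algebra_simps)
  also have "\<dots> = (\<Sum>i<p. ?c ((int k - int l) * int i) * (\<Sum>c<q. D i $$ (a, c) * G i $$ (c, b))) / of_nat p"
    by (subst sum.swap) (simp add: sum_distrib_left sum_divide_distrib)
  also have "\<dots> = (\<Sum>i<p. ?c ((int k - int l) * int i) * (D i * G i) $$ (a, b)) / of_nat p"
    using * by (simp add: mult_mat_index [OF D G])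
  also have "\<dots> = from_fourier m n (map (\<lambda>i. D i * G i) [0..<p]) $$ (k * m + a, l * n + b)"
    using * by (intro from_fourier_index [symmetric] mult_carrier_mat [OF D G]) auto
  finally show "(from_fourier m q (map D [0..<p]) * from_fourier q n (map G [0..<p])) $$ (k * m + a, l * n + b) =
    from_fourier m n (map (\<lambda>i. D i * G i) [0..<p]) $$ (k * m + a, l * n + b)" .
next
  show "from_fourier m q (map D [0..<p]) * from_fourier q n (map G [0..<p]) \<in> carrier_mat (p * m) (p * n)"
    by (rule mult_carrier_mat; rule from_fourier_carrier) (use D G in auto)
  show "from_fourier m n (map (\<lambda>i. D i * G i) [0..<p]) \<in> carrier_mat (p * m) (p * n)"
    by (rule from_fourier_carrier, rule mult_carrier_mat [OF D G])
qed

text \<open>Conjugation negates the exponent (l - k) i of the transposed block, which restores (k -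
  l) i.\<close>

lemma mat_adjoint_from_fourier:
  assumes D: "\<And>i. i < p \<Longrightarrow> D i \<in> carrier_mat m n"
  shows "mat_adjoint (from_fourier m n (map D [0..<p])) =
    from_fourier n m (map (\<lambda>i. mat_adjoint (D i)) [0..<p])"
proof (rule eq_block_matI [of _ p n p m])
  fix k l a b assume *: "k < p" "l < p" "a < n" "b < m"
  have adj: "mat_adjoint (D i) \<in> carrier_mat n m" if "i < p" for i using D that by simp
  have "mat_adjoint (from_fourier m n (map D [0..<p])) $$ (k * n + a, l * m + b) =
      cnj (from_fourier m n (map D [0..<p]) $$ (l * m + b, k * n + a))"
    using * block_index_less carrier_matD [OF from_fourier_carrier [OF D]]
    by (intro mat_adjoint_index) auto
  also have "\<dots> = (\<Sum>i<p. dft_char p ((int k - int l) * int i) * mat_adjoint (D i) $$ (a, b)) / of_nat p"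
    using * carrier_matD [OF D] from_fourier_index [OF D *(2,1,4,3)]
    by (simp add: cnj_dft_char left_diff_distrib)
  also have "\<dots> = from_fourier n m (map (\<lambda>i. mat_adjoint (D i)) [0..<p]) $$ (k * n + a, l * m + b)"
    by (rule from_fourier_index [OF adj, symmetric]) (use * in auto)
  finally show "mat_adjoint (from_fourier m n (map D [0..<p])) $$ (k * n + a, l * m + b) =
    from_fourier n m (map (\<lambda>i. mat_adjoint (D i)) [0..<p]) $$ (k * n + a, l * m + b)" .
qed (use from_fourier_carrier [OF D] from_fourier_carrier [of p "\<lambda>i. mat_adjoint (D i)" n m] D in auto)

text \<open>Fourier inversion, applied to the first block column, recovers each block.\<close>

lemma from_fourier_inject:
  assumes D: "\<And>i. i < p \<Longrightarrow> D i \<in> carrier_mat m n" and G: "\<And>i. i < p \<Longrightarrow> G i \<in> carrier_mat m n"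
    and eq: "from_fourier m n (map D [0..<p]) = from_fourier m n (map G [0..<p])"
    and i: "i < p"
  shows "D i = G i"
proof (rule eq_matI)
  fix a b assume "a < dim_row (G i)" "b < dim_col (G i)"
  then have ab: "a < m" "b < n" using G [OF i] by auto
  \<comment> \<open>The column is written \<open>0 * n + b\<close> to match the block form of
    \<open>from_fourier_index\<close>.\<close>
  have inv: "H i $$ (a, b) = (\<Sum>k<p. dft_char p (- (int k * int i)) *
      from_fourier m n (map H [0..<p]) $$ (k * m + a, 0 * n + b))"
    if H: "\<And>i. i < p \<Longrightarrow> H i \<in> carrier_mat m n" for H
  proof -
    have "(\<Sum>k<p. dft_char p (- (int k * int i)) *
        from_fourier m n (map H [0..<p]) $$ (k * m + a, 0 * n + b)) =
      (\<Sum>k<p. \<Sum>j<p. H j $$ (a, b) / of_nat p * dft_char p ((int j - int i) * int k))"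
    proof (intro sum.cong refl)
      fix k assume "k \<in> {..<p}"
      then have "from_fourier m n (map H [0..<p]) $$ (k * m + a, 0 * n + b) =
          (\<Sum>j<p. dft_char p ((int k - int 0) * int j) * H j $$ (a, b)) / of_nat p"
        using ab i by (intro from_fourier_index H) auto
      then have "dft_char p (- (int k * int i)) * from_fourier m n (map H [0..<p]) $$ (k * m + a, 0 * n + b) =
          (\<Sum>j<p. H j $$ (a, b) / of_nat p * (dft_char p (- (int k * int i)) * dft_char p (int k * int j)))"
        by (simp add: sum_divide_distrib sum_distrib_left mult_ac)
      also have "\<dots> = (\<Sum>j<p. H j $$ (a, b) / of_nat p * dft_char p ((int j - int i) * int k))"
        by (simp flip: dft_char_add add: algebra_simps)
      finally show "dft_char p (- (int k * int i)) * from_fourier m n (map H [0..<p]) $$ (k * m + a, 0 * n + b) =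
          (\<Sum>j<p. H j $$ (a, b) / of_nat p * dft_char p ((int j - int i) * int k))" .
    qed
    also have "\<dots> = (\<Sum>j<p. if j = i then H j $$ (a, b) else 0)"
      using i by (subst sum.swap, intro sum.cong refl, subst sum_distrib_left [symmetric])
        (simp add: sum_dft_char_diff)
    also have "\<dots> = H i $$ (a, b)" using i by simp
    finally show ?thesis by simp
  qed
  show "D i $$ (a, b) = G i $$ (a, b)"
    using inv [of D, OF D] inv [of G, OF G] eq by simp
qed (use carrier_matD [OF D [OF i]] carrier_matD [OF G [OF i]] in auto)

section \<open>Tensors with prescribed Fourier blocks\<close>

text \<open>Sizes are read from the head slice, which is unspecified for the empty list; hence
  \<open>p > 0\<close> in the last two claims.\<close>

lemma tensors_dims:
  assumes "T \<in> tensors m n p"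
  shows "length T = p" "k < p \<Longrightarrow> T ! k \<in> carrier_mat m n"
    "p > 0 \<Longrightarrow> trows T = m" "p > 0 \<Longrightarrow> tcols T = n"
proof -
  show len: "length T = p" using assms by (auto simp: tensors_def blocks_def)
  show nth: "T ! k \<in> carrier_mat m n" if "k < p" for k
    using assms that nth_mem [of k T] by (auto simp: tensors_def blocks_def)
  from len show "p > 0 \<Longrightarrow> trows T = m" "p > 0 \<Longrightarrow> tcols T = n"
    using nth [of 0] by (auto simp: trows_def tcols_def hd_conv_nth)
qed

lemma eq_tensorI:
  assumes "S \<in> tensors m n p" "T \<in> tensors m n p"
    and "\<And>k a b. k < p \<Longrightarrow> a < m \<Longrightarrow> b < n \<Longrightarrow> tentry S k a b = tentry T k a b"
  shows "S = T"
proof (rule nth_equalityI)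
  show "length S = length T" using tensors_dims(1) [OF assms(1)] tensors_dims(1) [OF assms(2)] by simp
  fix k assume "k < length S"
  then have k: "k < p" using tensors_dims(1) [OF assms(1)] by simp
  then show "S ! k = T ! k"
    using assms(3) [OF k] tensors_dims(2) [OF assms(1) k] tensors_dims(2) [OF assms(2) k]
    by (intro eq_matI) (auto simp: tentry_def)
qed

lemma mk_tensor_in_tensors [simp]: "mk_tensor m n p g \<in> tensors m n p"
  by (auto simp: mk_tensor_def tensors_def blocks_def)

lemma tentry_mk_tensor [simp]:
  "k < p \<Longrightarrow> a < m \<Longrightarrow> b < n \<Longrightarrow> tentry (mk_tensor m n p g) k a b = g k a b"
  by (simp add: mk_tensor_def tentry_def)

lemma bcirc_carrier:
  assumes "T \<in> tensors m n p" "p > 0"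
  shows "bcirc T \<in> carrier_mat (p * m) (p * n)"
  using tensors_dims [OF assms(1)] assms(2) by (auto simp: bcirc_def Let_def mult.commute)

lemma bcirc_index:
  assumes "T \<in> tensors m n p" "k < p" "l < p" "a < m" "b < n"
  shows "bcirc T $$ (k * m + a, l * n + b) = tentry T (nat ((int k - int l) mod int p)) a b"
proof -
  have "p > 0" using assms by simp
  then show ?thesis
    using assms tensors_dims [OF assms(1)] block_index_less(2) [of k p a m] block_index_less(2) [of l p b n]
    by (simp add: bcirc_def Let_def tentry_def)
qed

text \<open>The first block column of \<open>bcirc T\<close> lists the slices of \<open>T\<close>.
  Injectivity makes \<open>bcirc_inv\<close> a true left inverse of \<open>bcirc\<close> on tensors
  of the given size.\<close>

lemma inj_on_bcirc:
  assumes "p > 0"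
  shows "inj_on bcirc (tensors m n p)"
proof (rule inj_onI)
  fix S T assume S: "S \<in> tensors m n p" and T: "T \<in> tensors m n p" and eq: "bcirc S = bcirc T"
  show "S = T"
  proof (rule eq_tensorI [OF S T])
    fix k a b assume "k < p" "a < m" "b < n"
    then show "tentry S k a b = tentry T k a b"
      using bcirc_index [OF S, of k 0 a b] bcirc_index [OF T, of k 0 a b] eq by simp
  qed
qed

text \<open>The tensor with Fourier blocks \<open>D i\<close>: slice \<open>k\<close> is block (k,
  0) of the matrix in \<open>from_fourier_index\<close>. The explicit entries make it available
  without knowing beforehand that this matrix lies in the range of \<open>bcirc\<close>.\<close>

definition fourier_tensor :: "nat \<Rightarrow> nat \<Rightarrow> nat \<Rightarrow> (nat \<Rightarrow> complex mat) \<Rightarrow> tensor" where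
  "fourier_tensor m n p D = mk_tensor m n p
     (\<lambda>k a b. (\<Sum>i<p. dft_char p (int k * int i) * D i $$ (a, b)) / of_nat p)"

lemma fourier_tensor_in_tensors [simp]: "fourier_tensor m n p D \<in> tensors m n p"
  by (simp add: fourier_tensor_def)

lemma tentry_fourier_tensor:
  "k < p \<Longrightarrow> a < m \<Longrightarrow> b < n \<Longrightarrow>
    tentry (fourier_tensor m n p D) k a b = (\<Sum>i<p. dft_char p (int k * int i) * D i $$ (a, b)) / of_nat p"
  by (simp add: fourier_tensor_def)

lemma fourier_tensor_cong:
  "(\<And>i. i < p \<Longrightarrow> D i = G i) \<Longrightarrow> fourier_tensor m n p D = fourier_tensor m n p G"
  by (simp add: fourier_tensor_def)

lemma bcirc_fourier_tensor:
  assumes p: "p > 0" and D: "\<And>i. i < p \<Longrightarrow> D i \<in> carrier_mat m n"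
  shows "bcirc (fourier_tensor m n p D) = from_fourier m n (map D [0..<p])"
proof (rule eq_block_matI [of _ p m p n])
  fix k l a b assume *: "k < p" "l < p" "a < m" "b < n"
  have "nat ((int k - int l) mod int p) < p"
    using p by (simp add: nat_less_iff)
  then show "bcirc (fourier_tensor m n p D) $$ (k * m + a, l * n + b) =
      from_fourier m n (map D [0..<p]) $$ (k * m + a, l * n + b)"
    using * p
    by (simp add: bcirc_index [OF fourier_tensor_in_tensors] tentry_fourier_tensor
        from_fourier_index [OF D] dft_char_mod)
qed (use bcirc_carrier [OF fourier_tensor_in_tensors p] from_fourier_carrier [OF D] in auto)

lemma eq_fourier_tensorI:
  assumes p: "p > 0" and T: "T \<in> tensors m n p" and D: "\<And>i. i < p \<Longrightarrow> D i \<in> carrier_mat m n"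
    and eq: "bcirc T = from_fourier m n (map D [0..<p])"
  shows "T = fourier_tensor m n p D"
proof (rule inj_onD [OF inj_on_bcirc [OF p] _ T fourier_tensor_in_tensors])
  show "bcirc T = bcirc (fourier_tensor m n p D)"
    unfolding eq by (rule bcirc_fourier_tensor [OF p D, symmetric])
qed

lemma bcirc_inv_from_fourier:
  assumes p: "p > 0" and D: "\<And>i. i < p \<Longrightarrow> D i \<in> carrier_mat m n"
  shows "bcirc_inv m n p (from_fourier m n (map D [0..<p])) = fourier_tensor m n p D"
  using the_inv_into_f_f [OF inj_on_bcirc [OF p] fourier_tensor_in_tensors [of m n p D]]
  by (simp only: bcirc_inv_def bcirc_fourier_tensor [OF p D])

lemma fourier_tensor_inject:
  assumes p: "p > 0" and D: "\<And>i. i < p \<Longrightarrow> D i \<in> carrier_mat m n" and G: "\<And>i. i < p \<Longrightarrow> G i \<in> carrier_mat m n"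
    and eq: "fourier_tensor m n p D = fourier_tensor m n p G" and i: "i < p"
  shows "D i = G i"
proof (rule from_fourier_inject [OF D G _ i])
  show "from_fourier m n (map D [0..<p]) = from_fourier m n (map G [0..<p])"
    using arg_cong [OF eq, of bcirc]
    by (simp only: bcirc_fourier_tensor [OF p D] bcirc_fourier_tensor [OF p G])
qed

text \<open>\<open>tunfold\<close> is the first block column of \<open>bcirc\<close>. The T-product
  is thus the first block column of the product of the two block circulant matrices, and that
  product comes from the blocks \<open>D i * G i\<close>.\<close>

lemma tprod_fourier_tensor:
  assumes p: "p > 0" and D: "\<And>i. i < p \<Longrightarrow> D i \<in> carrier_mat m q" and G: "\<And>i. i < p \<Longrightarrow> G i \<in> carrier_mat q n"
  shows "fourier_tensor m q p D *\<^sub>t fourier_tensor q n p G = fourier_tensor m n p (\<lambda>i. D i * G i)"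
proof -
  let ?D = "fourier_tensor m q p D" and ?G = "fourier_tensor q n p G"
  note dims = tensors_dims [OF fourier_tensor_in_tensors]
  have u: "tunfold ?G \<in> carrier_mat (p * q) n"
    using p by (auto simp: tunfold_def dims mult.commute)
  have bD: "bcirc ?D \<in> carrier_mat (p * m) (p * q)" and bG: "bcirc ?G \<in> carrier_mat (p * q) (p * n)"
    using p by (auto intro!: bcirc_carrier)
  have uG: "tunfold ?G $$ (k * q + c, b) = bcirc ?G $$ (k * q + c, 0 * n + b)" if "k < p" "c < q" "b < n" for k c b
    using that p block_index_less(2) [of k p c q]
    by (subst bcirc_index) (auto simp: tunfold_def dims tentry_def)
  have *: "?D *\<^sub>t ?G = tfold m p (bcirc ?D * tunfold ?G)"
    using p by (simp add: tprod_def dims)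
  show ?thesis
  proof (rule eq_tensorI)
    show "?D *\<^sub>t ?G \<in> tensors m n p" using u unfolding * tfold_def by simp
    fix k a b assume kab: "k < p" "a < m" "b < n"
    have "tentry (?D *\<^sub>t ?G) k a b = (bcirc ?D * tunfold ?G) $$ (k * m + a, b)"
      using u kab unfolding * tfold_def by simp
    also have "\<dots> = (\<Sum>x<p. \<Sum>c<q. bcirc ?D $$ (k * m + a, x * q + c) * tunfold ?G $$ (x * q + c, b))"
      by (rule mult_block_mat_index [OF bD u]) (use kab block_index_less in auto)
    also have "\<dots> = (\<Sum>x<p. \<Sum>c<q. bcirc ?D $$ (k * m + a, x * q + c) * bcirc ?G $$ (x * q + c, 0 * n + b))"
      using kab by (intro sum.cong refl) (subst uG, auto)
    also have "\<dots> = (bcirc ?D * bcirc ?G) $$ (k * m + a, 0 * n + b)"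
      by (rule mult_block_mat_index [OF bD bG, symmetric]) (use kab block_index_less [of 0 p b n] block_index_less in auto)
    also have "bcirc ?D * bcirc ?G = bcirc (fourier_tensor m n p (\<lambda>i. D i * G i))"
      by (simp add: bcirc_fourier_tensor p D G from_fourier_mult [OF D G p] mult_carrier_mat [OF D G])
    also have "\<dots> $$ (k * m + a, 0 * n + b) = tentry (fourier_tensor m n p (\<lambda>i. D i * G i)) k a b"
      using kab p by (subst bcirc_index) auto
    finally show "tentry (?D *\<^sub>t ?G) k a b = tentry (fourier_tensor m n p (\<lambda>i. D i * G i)) k a b" .
  qed simp
qed

text \<open>Reversing slices 2 to p is the map k |-> - k mod p on slice indices. It negates the
  exponents of the characters, and the conjugation in the adjoint negates them back.\<close>

lemma tadjoint_fourier_tensor: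
  assumes p: "p > 0" and D: "\<And>i. i < p \<Longrightarrow> D i \<in> carrier_mat m n"
  shows "tadjoint (fourier_tensor m n p D) = fourier_tensor n m p (\<lambda>i. mat_adjoint (D i))"
proof -
  let ?T = "fourier_tensor m n p D"
  note dims = tensors_dims [OF fourier_tensor_in_tensors]
  show ?thesis
  proof (rule eq_tensorI)
    show "tadjoint ?T \<in> tensors n m p"
      using p by (auto simp: tadjoint_def tensors_def blocks_def dims intro!: mat_adjoint_carrier)
    fix k a b assume kab: "k < p" "a < n" "b < m"
    let ?k = "(p - k) mod p"
    have k': "?k < p" using p by simp
    have "int ?k = (- int k) mod int p"
      using kab by (simp add: of_nat_mod of_nat_diff)
    then have ch: "dft_char p (- (int ?k * int i)) = dft_char p (int k * int i)" for i
      using dft_char_mod [OF p, of "- int k" "int i"] cnj_dft_char [of p]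
      by (metis minus_minus mult_minus_left)
    have "tentry (tadjoint ?T) k a b = mat_adjoint (?T ! ?k) $$ (a, b)"
      using kab by (simp add: tadjoint_def tentry_def dims)
    also have "\<dots> = cnj (tentry ?T ?k b a)"
      using kab dims(2) [OF k', of m n D] by (simp add: tentry_def)
    also have "\<dots> = (\<Sum>i<p. dft_char p (int k * int i) * mat_adjoint (D i) $$ (a, b)) / of_nat p"
      using kab carrier_matD [OF D] k' by (simp add: tentry_fourier_tensor cnj_dft_char ch)
    also have "\<dots> = tentry (fourier_tensor n m p (\<lambda>i. mat_adjoint (D i))) k a b"
      using kab by (simp add: tentry_fourier_tensor)
    finally show "tentry (tadjoint ?T) k a b = tentry (fourier_tensor n m p (\<lambda>i. mat_adjoint (D i))) k a b" .
  qed simp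
qed

section \<open>Linear operations and the Moore-Penrose inverse on Fourier blocks\<close>

lemma tminus_fourier_tensor:
  assumes D: "\<And>i. i < p \<Longrightarrow> D i \<in> carrier_mat m n" and G: "\<And>i. i < p \<Longrightarrow> G i \<in> carrier_mat m n"
  shows "fourier_tensor m n p D -\<^sub>t fourier_tensor m n p G = fourier_tensor m n p (\<lambda>i. D i - G i)"
proof (rule eq_tensorI)
  note dims = tensors_dims [OF fourier_tensor_in_tensors]
  show "fourier_tensor m n p D -\<^sub>t fourier_tensor m n p G \<in> tensors m n p"
    by (auto simp: tminus_def tensors_def blocks_def dims set_zip intro!: minus_carrier_mat)
  fix k a b assume kab: "k < p" "a < m" "b < n"
  have "tentry (fourier_tensor m n p D -\<^sub>t fourier_tensor m n p G) k a b =
      tentry (fourier_tensor m n p D) k a b - tentry (fourier_tensor m n p G) k a b"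
    using kab carrier_matD [OF tensors_dims(2) [OF fourier_tensor_in_tensors [of m n p G] kab(1)]]
    by (simp add: tminus_def tentry_def dims)
  also have "\<dots> = tentry (fourier_tensor m n p (\<lambda>i. D i - G i)) k a b"
    using kab carrier_matD [OF G]
    by (simp add: tentry_fourier_tensor right_diff_distrib sum_subtractf diff_divide_distrib)
  finally show "tentry (fourier_tensor m n p D -\<^sub>t fourier_tensor m n p G) k a b =
      tentry (fourier_tensor m n p (\<lambda>i. D i - G i)) k a b" .
qed simp

lemma tsmult_fourier_tensor:
  assumes D: "\<And>i. i < p \<Longrightarrow> D i \<in> carrier_mat m n"
  shows "c \<cdot>\<^sub>t fourier_tensor m n p D = fourier_tensor m n p (\<lambda>i. c \<cdot>\<^sub>m D i)"
proof (rule eq_tensorI)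
  note dims = tensors_dims [OF fourier_tensor_in_tensors]
  show "c \<cdot>\<^sub>t fourier_tensor m n p D \<in> tensors m n p"
    using fourier_tensor_in_tensors [of m n p D]
    by (auto simp: tsmult_def tensors_def blocks_def)
  fix k a b assume kab: "k < p" "a < m" "b < n"
  have "tentry (c \<cdot>\<^sub>t fourier_tensor m n p D) k a b = c * tentry (fourier_tensor m n p D) k a b"
    using kab carrier_matD [OF tensors_dims(2) [OF fourier_tensor_in_tensors [of m n p D] kab(1)]]
    by (simp add: tsmult_def tentry_def dims)
  also have "\<dots> = tentry (fourier_tensor m n p (\<lambda>i. c \<cdot>\<^sub>m D i)) k a b"
    using kab carrier_matD [OF D]
    by (simp add: tentry_fourier_tensor sum_distrib_left mult.left_commute)
  finally show "tentry (c \<cdot>\<^sub>t fourier_tensor m n p D) k a b =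
      tentry (fourier_tensor m n p (\<lambda>i. c \<cdot>\<^sub>m D i)) k a b" .
qed simp

text \<open>\<open>A * X\<close> and \<open>A * Y\<close> are both the orthogonal projection onto
  the range of \<open>A\<close>, and \<open>X * A\<close> and \<open>Y * A\<close> both the one onto
  the orthogonal complement of its kernel. Hence X = X A X = X A Y = Y A Y = Y.\<close>

lemma penrose_unique:
  fixes A X Y :: "complex mat"
  assumes A: "A \<in> carrier_mat m n" and X: "X \<in> carrier_mat n m" and Y: "Y \<in> carrier_mat n m"
    and pX: "A * X * A = A" "X * A * X = X" "mat_adjoint (A * X) = A * X" "mat_adjoint (X * A) = X * A"
    and pY: "A * Y * A = A" "Y * A * Y = Y" "mat_adjoint (A * Y) = A * Y" "mat_adjoint (Y * A) = Y * A"
  shows "X = Y"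
proof -
  note c = A X Y mult_carrier_mat [OF A X] mult_carrier_mat [OF A Y] mult_carrier_mat [OF X A] mult_carrier_mat [OF Y A]
  have 1: "A * X = A * Y"
  proof -
    \<comment> \<open>From A = A Y A and the self-adjointness of \<open>A * X\<close>; taking the
      adjoint then exchanges the two projections.\<close>
    have "A * X = mat_adjoint (A * Y * (A * X))"
    proof -
      have "A * X = A * Y * A * X" using pY(1) by simp
      also have "\<dots> = A * Y * (A * X)" by (rule assoc_mult_mat [OF c(5) A X])
      finally show ?thesis using pX(3) by simp
    qed
    also have "\<dots> = A * X * (A * Y)"
      by (simp only: mat_adjoint_mult [OF c(5,4)] pX(3) pY(3))
    also have "\<dots> = A * X * A * Y" by (rule assoc_mult_mat [OF c(4) A Y, symmetric])
    finally show ?thesis using pX(1) by simp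
  qed
  have 2: "X * A = Y * A"
  proof -
    have "X * A = mat_adjoint (X * A * (Y * A))"
    proof -
      have "X * A = X * (A * Y * A)" using pY(1) by simp
      also have "\<dots> = X * (A * (Y * A))" using assoc_mult_mat [OF A Y A] by simp
      also have "\<dots> = X * A * (Y * A)" by (rule assoc_mult_mat [OF X A c(7), symmetric])
      finally show ?thesis using pX(4) by simp
    qed
    also have "\<dots> = Y * A * (X * A)"
      by (simp only: mat_adjoint_mult [OF c(6,7)] pX(4) pY(4))
    also have "\<dots> = Y * (A * (X * A))" by (rule assoc_mult_mat [OF Y A c(6)])
    also have "A * (X * A) = A * X * A" by (rule assoc_mult_mat [OF A X A, symmetric])
    finally show ?thesis using pX(1) by simp
  qed
  have "X = X * (A * X)" using pX(2) assoc_mult_mat [OF X A X] by simp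
  also have "\<dots> = X * A * Y" using 1 assoc_mult_mat [OF X A Y] by simp
  also have "\<dots> = Y" using 2 pY(2) by simp
  finally show ?thesis .
qed

lemma mat_pinvI:
  fixes A X :: "complex mat"
  assumes A: "A \<in> carrier_mat m n" and X: "X \<in> carrier_mat n m"
    and pX: "A * X * A = A" "X * A * X = X" "mat_adjoint (A * X) = A * X" "mat_adjoint (X * A) = X * A"
  shows "mat_pinv A = X"
  unfolding mat_pinv_def
proof (rule the_equality)
  fix Y assume "Y \<in> carrier_mat (dim_col A) (dim_row A) \<and> A * Y * A = A \<and> Y * A * Y = Y \<and>
    mat_adjoint (A * Y) = A * Y \<and> mat_adjoint (Y * A) = Y * A"
  then show "Y = X" using penrose_unique [OF A X _ pX] A by auto
qed (use assms in auto)

text \<open>Passing to Fourier blocks respects products and adjoints, so the Penrose equations hold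
  for the large matrices as soon as they hold in each block.\<close>

lemma tpinv_fourier_tensor:
  assumes p: "p > 0" and D: "\<And>i. i < p \<Longrightarrow> D i \<in> carrier_mat m n" and X: "\<And>i. i < p \<Longrightarrow> X i \<in> carrier_mat n m"
    and "\<And>i. i < p \<Longrightarrow> D i * X i * D i = D i" "\<And>i. i < p \<Longrightarrow> X i * D i * X i = X i"
    and "\<And>i. i < p \<Longrightarrow> mat_adjoint (D i * X i) = D i * X i" "\<And>i. i < p \<Longrightarrow> mat_adjoint (X i * D i) = X i * D i"
  shows "tpinv (fourier_tensor m n p D) = fourier_tensor n m p X"
proof -
  note dims = tensors_dims [OF fourier_tensor_in_tensors]
  note DX = mult_carrier_mat [OF D X] and XD = mult_carrier_mat [OF X D]
  let ?D = "from_fourier m n (map D [0..<p])" and ?X = "from_fourier n m (map X [0..<p])"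
  have cong: "from_fourier k l (map F [0..<p]) = from_fourier k l (map G [0..<p])"
    if "\<And>i. i < p \<Longrightarrow> F i = G i" for k l F G
    using that by (metis (no_types, lifting) atLeastLessThan_iff map_cong set_upt)
  have "mat_pinv ?D = ?X"
  proof (rule mat_pinvI)
    show "?D \<in> carrier_mat (p * m) (p * n)" "?X \<in> carrier_mat (p * n) (p * m)"
      by (intro from_fourier_carrier D X; assumption)+
    have DX': "?D * ?X = from_fourier m m (map (\<lambda>i. D i * X i) [0..<p])"
      and XD': "?X * ?D = from_fourier n n (map (\<lambda>i. X i * D i) [0..<p])"
      by (intro from_fourier_mult D X p; assumption)+
    show "?D * ?X * ?D = ?D"
      unfolding DX' by (subst from_fourier_mult [OF DX D p]) (auto intro: cong assms)
    show "?X * ?D * ?X = ?X"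
      unfolding XD' by (subst from_fourier_mult [OF XD X p]) (auto intro: cong assms)
    show "mat_adjoint (?D * ?X) = ?D * ?X"
      unfolding DX' by (subst mat_adjoint_from_fourier [OF DX]) (auto intro: cong assms)
    show "mat_adjoint (?X * ?D) = ?X * ?D"
      unfolding XD' by (subst mat_adjoint_from_fourier [OF XD]) (auto intro: cong assms)
  qed
  then show ?thesis
    using p bcirc_inv_from_fourier [OF p X] by (simp add: tpinv_def dims bcirc_fourier_tensor [OF p D])
qed

section \<open>Sums of rank-one matrices\<close>

lemma mat_unitary_carrier: "mat_unitary n Q \<Longrightarrow> Q \<in> carrier_mat n n"
  by (simp add: mat_unitary_def)

lemma mat_unitary_cols:
  assumes Q: "mat_unitary n Q" and "j < n" "k < n"
  shows "(\<Sum>a<n. cnj (Q $$ (a, j)) * Q $$ (a, k)) = (if j = k then 1 else 0)"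
proof -
  have C: "Q \<in> carrier_mat n n" and "mat_adjoint Q * Q = 1\<^sub>m n"
    using Q by (auto simp: mat_unitary_def)
  then have "(mat_adjoint Q * Q) $$ (j, k) = (if j = k then 1 else 0)"
    using assms by simp
  then show ?thesis
    using mult_mat_index [OF mat_adjoint_carrier [OF C] C assms(2,3)] carrier_matD [OF C] assms(2,3)
    by simp
qed

lemma mat_unitary_rows:
  assumes Q: "mat_unitary n Q" and "a < n" "b < n"
  shows "(\<Sum>j<n. Q $$ (a, j) * cnj (Q $$ (b, j))) = (if a = b then 1 else 0)"
proof -
  have C: "Q \<in> carrier_mat n n" and "Q * mat_adjoint Q = 1\<^sub>m n"
    using Q by (auto simp: mat_unitary_def)
  then have "(Q * mat_adjoint Q) $$ (a, b) = (if a = b then 1 else 0)"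
    using assms by simp
  then show ?thesis
    using mult_mat_index [OF C mat_adjoint_carrier [OF C] assms(2,3)] carrier_matD [OF C] assms(2,3)
    by simp
qed

text \<open>A singular value decomposition with arbitrary complex coefficients in place of singular
  values. For unitary \<open>U\<close> and \<open>V\<close>, differences, products, adjoints and
  Moore-Penrose inverses then act on \<open>g\<close> alone.\<close>

definition svd_mat ::
    "nat \<Rightarrow> nat \<Rightarrow> nat \<Rightarrow> complex mat \<Rightarrow> complex mat \<Rightarrow> (nat \<Rightarrow> complex) \<Rightarrow> complex mat" where
  "svd_mat m n r U V g = Matrix.mat m n (\<lambda>(a, b). \<Sum>j<r. g j * U $$ (a, j) * cnj (V $$ (b, j)))"

lemma svd_mat_carrier [simp]: "svd_mat m n r U V g \<in> carrier_mat m n"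
  by (simp add: svd_mat_def)

lemma svd_mat_index:
  "a < m \<Longrightarrow> b < n \<Longrightarrow> svd_mat m n r U V g $$ (a, b) = (\<Sum>j<r. g j * U $$ (a, j) * cnj (V $$ (b, j)))"
  by (simp add: svd_mat_def)

lemma svd_mat_cong:
  "(\<And>j. j < r \<Longrightarrow> g j = h j) \<Longrightarrow> svd_mat m n r U V g = svd_mat m n r U V h"
  by (simp add: svd_mat_def)

lemma svd_mat_extend:
  assumes "r \<le> q"
  shows "svd_mat m n r U V g = svd_mat m n q U V (\<lambda>j. if j < r then g j else 0)"
proof (rule eq_matI)
  fix a b assume "a < dim_row (svd_mat m n q U V (\<lambda>j. if j < r then g j else 0))"
    "b < dim_col (svd_mat m n q U V (\<lambda>j. if j < r then g j else 0))"
  then have ab: "a < m" "b < n" by (auto simp: svd_mat_def)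
  have "(\<Sum>j<r. g j * U $$ (a, j) * cnj (V $$ (b, j))) =
      (\<Sum>j<q. (if j < r then g j else 0) * U $$ (a, j) * cnj (V $$ (b, j)))"
    using assms by (intro sum.mono_neutral_cong_left) auto
  then show "svd_mat m n r U V g $$ (a, b) = svd_mat m n q U V (\<lambda>j. if j < r then g j else 0) $$ (a, b)"
    using ab by (simp add: svd_mat_index)
qed (auto simp: svd_mat_def)

text \<open>Orthonormality of the columns v_k: the matrix sends v_j to g_j u_j for j < r and every
  later column of \<open>V\<close> to 0.\<close>

lemma svd_mat_mult_col:
  assumes V: "mat_unitary n V" and r: "r \<le> n" and "a < m" "j < n"
  shows "(\<Sum>b<n. svd_mat m n r U V g $$ (a, b) * V $$ (b, j)) = (if j < r then g j else 0) * U $$ (a, j)"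
proof -
  have "(\<Sum>b<n. svd_mat m n r U V g $$ (a, b) * V $$ (b, j)) =
      (\<Sum>b<n. \<Sum>k<r. g k * U $$ (a, k) * (cnj (V $$ (b, k)) * V $$ (b, j)))"
    using assms(3) by (simp add: svd_mat_index sum_distrib_right mult.assoc)
  also have "\<dots> = (\<Sum>k<r. g k * U $$ (a, k) * (\<Sum>b<n. cnj (V $$ (b, k)) * V $$ (b, j)))"
    by (subst sum.swap) (simp add: sum_distrib_left)
  also have "\<dots> = (\<Sum>k<r. if k = j then g k * U $$ (a, k) else 0)"
    using r \<open>j < n\<close> by (intro sum.cong refl) (simp add: mat_unitary_cols [OF V])
  finally show ?thesis by simp
qed

text \<open>The inner product v_k^H v_l is 1 for k = l and 0 otherwise, so only products of terms
  with equal index survive.\<close>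

lemma svd_mat_mult:
  assumes V: "mat_unitary n V" and r: "r \<le> n"
  shows "svd_mat m n r U V g * svd_mat n s r V W h = svd_mat m s r U W (\<lambda>j. g j * h j)"
proof (rule eq_matI)
  fix a b assume "a < dim_row (svd_mat m s r U W (\<lambda>j. g j * h j))"
    "b < dim_col (svd_mat m s r U W (\<lambda>j. g j * h j))"
  then have ab: "a < m" "b < s" by (auto simp: svd_mat_def)
  have "(svd_mat m n r U V g * svd_mat n s r V W h) $$ (a, b) =
      (\<Sum>c<n. svd_mat m n r U V g $$ (a, c) * svd_mat n s r V W h $$ (c, b))"
    using ab by (intro mult_mat_index) auto
  also have "\<dots> = (\<Sum>c<n. \<Sum>j<r. svd_mat m n r U V g $$ (a, c) * V $$ (c, j) * (h j * cnj (W $$ (b, j))))"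
    using ab by (simp add: svd_mat_index [of _ n] sum_distrib_left mult_ac)
  also have "\<dots> = (\<Sum>j<r. (\<Sum>c<n. svd_mat m n r U V g $$ (a, c) * V $$ (c, j)) * (h j * cnj (W $$ (b, j))))"
    by (subst sum.swap) (simp add: sum_distrib_right)
  also have "\<dots> = (\<Sum>j<r. g j * h j * U $$ (a, j) * cnj (W $$ (b, j)))"
    using r ab by (intro sum.cong refl) (simp add: svd_mat_mult_col [OF V r])
  finally show "(svd_mat m n r U V g * svd_mat n s r V W h) $$ (a, b) =
      svd_mat m s r U W (\<lambda>j. g j * h j) $$ (a, b)"
    using ab by (simp add: svd_mat_index)
qed (auto simp: svd_mat_def)

lemma mat_adjoint_svd_mat:
  "mat_adjoint (svd_mat m n r U V g) = svd_mat n m r V U (\<lambda>j. cnj (g j))"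
  by (rule eq_matI) (auto simp: svd_mat_def mult_ac)

lemma smult_svd_mat: "c \<cdot>\<^sub>m svd_mat m n r U V g = svd_mat m n r U V (\<lambda>j. c * g j)"
  by (rule eq_matI) (auto simp: svd_mat_def sum_distrib_left mult_ac)

lemma minus_svd_mat:
  "svd_mat m n r U V g - svd_mat m n r U V h = svd_mat m n r U V (\<lambda>j. g j - h j)"
  by (rule eq_matI) (auto simp: svd_mat_def sum_subtractf left_diff_distrib)

text \<open>The Penrose equations reduce to those of the scalars g_j. With
  \<open>inverse 0 = 0\<close> the scalar inverse is exactly the Moore-Penrose inverse of a number,
  so vanishing coefficients are covered.\<close>

lemma svd_mat_penrose:
  fixes g :: "nat \<Rightarrow> complex"
  assumes U: "mat_unitary m U" and V: "mat_unitary n V" and r: "r \<le> m" "r \<le> n"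
  defines "D \<equiv> svd_mat m n r U V g" and "X \<equiv> svd_mat n m r V U (\<lambda>j. inverse (g j))"
  shows "D * X * D = D" "X * D * X = X" "mat_adjoint (D * X) = D * X" "mat_adjoint (X * D) = X * D"
proof -
  have proj: "cnj (z * inverse z) = z * inverse z" "cnj (inverse z * z) = inverse z * z" for z :: complex
    by (cases "z = 0"; simp)+
  have mpi: "z * inverse z * z = z" "inverse z * z * inverse z = inverse z" for z :: complex
    by (cases "z = 0"; simp)+
  show "D * X * D = D" "X * D * X = X" "mat_adjoint (D * X) = D * X" "mat_adjoint (X * D) = X * D"
    unfolding D_def X_def svd_mat_mult [OF V r(2)] svd_mat_mult [OF U r(1)] mat_adjoint_svd_mat proj mpi
    by (rule refl)+
qed

text \<open>The coefficient is recovered from the common matrix M as u_j^H M v_j.\<close>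

lemma svd_mat_inject:
  assumes U: "mat_unitary m U" and V: "mat_unitary n V" and r: "r \<le> m" "r \<le> n"
    and eq: "svd_mat m n r U V g = svd_mat m n r U V h" and j: "j < r"
  shows "g j = h j"
proof -
  have coeff: "(\<Sum>a<m. (\<Sum>b<n. svd_mat m n r U V f $$ (a, b) * V $$ (b, j)) * cnj (U $$ (a, j))) = f j" for f
  proof -
    have "(\<Sum>a<m. (\<Sum>b<n. svd_mat m n r U V f $$ (a, b) * V $$ (b, j)) * cnj (U $$ (a, j))) =
        (\<Sum>a<m. f j * U $$ (a, j) * cnj (U $$ (a, j)))"
      using j r by (intro sum.cong refl) (simp add: svd_mat_mult_col [OF V r(2)])
    also have "\<dots> = f j * (\<Sum>a<m. cnj (U $$ (a, j)) * U $$ (a, j))"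
      by (simp add: sum_distrib_left mult_ac)
    finally have "(\<Sum>a<m. (\<Sum>b<n. svd_mat m n r U V f $$ (a, b) * V $$ (b, j)) * cnj (U $$ (a, j))) =
        f j * (\<Sum>a<m. cnj (U $$ (a, j)) * U $$ (a, j))" .
    then show ?thesis using j r by (simp add: mat_unitary_cols [OF U])
  qed
  show ?thesis using coeff [of g] coeff [of h] eq by simp
qed

text \<open>Both sides are the number u_i^H M v_j for the common matrix M, with u_i taken from
  \<open>U2\<close> and v_j from \<open>V1\<close>. The first expansion evaluates M v_j, the second
  u_i^H M.\<close>

lemma svd_mat_sandwich:
  assumes "svd_mat m n r1 U1 V1 g = svd_mat m n r2 U2 V2 h"
    and U2: "mat_unitary m U2" and V1: "mat_unitary n V1" and r: "r1 \<le> n" "r2 \<le> m"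
    and "i < m" "j < n"
  shows "(if j < r1 then g j else 0) * (\<Sum>a<m. cnj (U2 $$ (a, i)) * U1 $$ (a, j)) =
    (if i < r2 then h i else 0) * (\<Sum>b<n. cnj (V2 $$ (b, i)) * V1 $$ (b, j))"
proof -
  let ?S = "svd_mat m n r1 U1 V1 g"
  have "(\<Sum>a<m. \<Sum>b<n. cnj (U2 $$ (a, i)) * ?S $$ (a, b) * V1 $$ (b, j)) =
      (\<Sum>a<m. cnj (U2 $$ (a, i)) * (\<Sum>b<n. ?S $$ (a, b) * V1 $$ (b, j)))"
    by (simp add: sum_distrib_left mult.assoc)
  also have "\<dots> = (\<Sum>a<m. cnj (U2 $$ (a, i)) * ((if j < r1 then g j else 0) * U1 $$ (a, j)))"
    using \<open>j < n\<close> by (intro sum.cong refl) (simp only: svd_mat_mult_col [OF V1 r(1)] lessThan_iff)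
  also have "\<dots> = (if j < r1 then g j else 0) * (\<Sum>a<m. cnj (U2 $$ (a, i)) * U1 $$ (a, j))"
    by (simp only: sum_distrib_left mult.left_commute)
  finally have 1: "(\<Sum>a<m. \<Sum>b<n. cnj (U2 $$ (a, i)) * ?S $$ (a, b) * V1 $$ (b, j)) =
    (if j < r1 then g j else 0) * (\<Sum>a<m. cnj (U2 $$ (a, i)) * U1 $$ (a, j))" .
  \<comment> \<open>Passing to the adjoint turns multiplication by u_i^H from the left into
    multiplication by u_i from the right, so that \<open>svd_mat_mult_col\<close> applies
    again.\<close>
  have S: "?S $$ (a, b) = cnj (svd_mat n m r2 V2 U2 (\<lambda>j. cnj (h j)) $$ (b, a))" if "a < m" "b < n" for a b
    using that unfolding assms(1) by (simp add: svd_mat_index mult_ac)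
  have "(\<Sum>a<m. \<Sum>b<n. cnj (U2 $$ (a, i)) * ?S $$ (a, b) * V1 $$ (b, j)) =
      (\<Sum>b<n. cnj (\<Sum>a<m. svd_mat n m r2 V2 U2 (\<lambda>j. cnj (h j)) $$ (b, a) * U2 $$ (a, i)) * V1 $$ (b, j))"
    by (subst sum.swap) (simp add: S sum_distrib_left sum_distrib_right mult_ac)
  also have "\<dots> = (\<Sum>b<n. cnj ((if i < r2 then cnj (h i) else 0) * V2 $$ (b, i)) * V1 $$ (b, j))"
    using \<open>i < m\<close> by (intro sum.cong refl) (simp only: svd_mat_mult_col [OF U2 r(2)] lessThan_iff)
  also have "\<dots> = (if i < r2 then h i else 0) * (\<Sum>b<n. cnj (V2 $$ (b, i)) * V1 $$ (b, j))"
    by (simp add: sum_distrib_left mult.assoc)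
  finally show ?thesis using 1 by simp
qed

text \<open>
  With \<open>W = U2\<^sup>H U1\<close> and \<open>X = V2\<^sup>H V1\<close>, equality of the two sums means
  \<open>g\<^sub>j W\<^sub>i\<^sub>j = h\<^sub>i X\<^sub>i\<^sub>j\<close> and \<open>h\<^sub>i W\<^sub>i\<^sub>j = g\<^sub>j X\<^sub>i\<^sub>j\<close>. Hence \<open>W\<^sub>i\<^sub>j = X\<^sub>i\<^sub>j\<close> if
  \<open>g\<^sub>j = h\<^sub>i > 0\<close>, and both entries vanish if \<open>g\<^sub>j \<noteq> h\<^sub>i\<close> are positive, so that
  \<open>F g\<^sub>j W\<^sub>i\<^sub>j = F h\<^sub>i X\<^sub>i\<^sub>j\<close>.
\<close>

lemma svd_mat_map_unique:
  fixes g h :: "nat \<Rightarrow> real"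
  assumes U1: "mat_unitary m U1" and V1: "mat_unitary n V1" and U2: "mat_unitary m U2" and V2: "mat_unitary n V2"
    and r: "r \<le> m" "r \<le> n"
    and nonneg: "\<And>j. j < r \<Longrightarrow> g j \<ge> 0" "\<And>j. j < r \<Longrightarrow> h j \<ge> 0"
    and eq: "svd_mat m n r U1 V1 (\<lambda>j. of_real (g j)) = svd_mat m n r U2 V2 (\<lambda>j. of_real (h j))"
    and F0: "F 0 = 0"
  shows "svd_mat m n r U1 V1 (\<lambda>j. F (g j)) = svd_mat m n r U2 V2 (\<lambda>j. F (h j))"
proof (rule eq_matI)
  fix a b assume "a < dim_row (svd_mat m n r U2 V2 (\<lambda>j. F (h j)))"
    "b < dim_col (svd_mat m n r U2 V2 (\<lambda>j. F (h j)))"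
  then have ab: "a < m" "b < n" by (auto simp: svd_mat_def)
  \<comment> \<open>Padding with 0 lets \<open>i\<close> run over all columns of \<open>U2\<close>
    and \<open>j\<close> over all columns of \<open>V1\<close>, whose completeness is used
    below.\<close>
  define g' where "g' = (\<lambda>j. if j < r then g j else 0)"
  define h' where "h' = (\<lambda>j. if j < r then h j else 0)"
  define W where "W = (\<lambda>i j. \<Sum>a<m. cnj (U2 $$ (a, i)) * U1 $$ (a, j))"
  define X where "X = (\<lambda>i j. \<Sum>b<n. cnj (V2 $$ (b, i)) * V1 $$ (b, j))"
  have of_real': "of_real (g' j) = (if j < r then complex_of_real (g j) else 0)"
    "of_real (h' j) = (if j < r then complex_of_real (h j) else 0)" for j
    by (auto simp: g'_def h'_def)
  have pos: "g' j \<ge> 0" "h' j \<ge> 0" for j using nonneg by (auto simp: g'_def h'_def)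
  have FWX: "F (g' j) * W i j = F (h' i) * X i j" if "i < m" "j < n" for i j
  proof -
    have 1: "of_real (g' j) * W i j = of_real (h' i) * X i j"
      using svd_mat_sandwich [OF eq U2 V1 r(2,1) that]
      by (simp only: W_def X_def of_real')
    show ?thesis
    proof (cases "g' j = 0 \<or> h' i = 0")
      \<comment> \<open>If one coefficient vanishes, the equation forces the other coefficient or
        its overlap to be 0; both sides vanish since \<open>F 0 = 0\<close>.\<close>
      case True
      then show ?thesis using 1 F0 by auto
    next
      case nz: False
      then have ij: "i < r" "j < r" by (auto simp: g'_def h'_def split: if_splits)
      \<comment> \<open>The same identity with the two decompositions exchanged; conjugation turns
        its overlaps back into \<open>W\<close> and \<open>X\<close>.\<close>
      have "of_real (h' i) * (\<Sum>a<m. cnj (U1 $$ (a, j)) * U2 $$ (a, i)) =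
          of_real (g' j) * (\<Sum>b<n. cnj (V1 $$ (b, j)) * V2 $$ (b, i))"
        using svd_mat_sandwich [OF eq [symmetric] U1 V2 r(2,1), of j i] ij r
        by (simp only: of_real')
      from arg_cong [OF this, of cnj] have 2: "of_real (h' i) * W i j = of_real (g' j) * X i j"
        by (simp add: W_def X_def mult_ac)
      show ?thesis
      proof (cases "g' j = h' i")
        case True
        then show ?thesis using 1 nz by auto
      next
        case False
        \<comment> \<open>Substituting one relation into the other gives (g^2 - h^2) W = 0, and
          distinct nonnegative reals have distinct squares.\<close>
        have "of_real ((g' j)\<^sup>2) * W i j = of_real (g' j) * (of_real (h' i) * X i j)"
          unfolding 1 [symmetric] by (simp add: power2_eq_square)
        also have "\<dots> = of_real (h' i) * (of_real (h' i) * W i j)"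
          unfolding 2 by simp
        finally have "of_real ((g' j)\<^sup>2 - (h' i)\<^sup>2) * W i j = 0"
          by (simp add: power2_eq_square algebra_simps)
        moreover have "(g' j)\<^sup>2 - (h' i)\<^sup>2 \<noteq> 0"
          using False pos by (simp add: power2_eq_iff_nonneg)
        ultimately have "W i j = 0" by (metis mult_eq_0_iff of_real_eq_0_iff)
        then show ?thesis using 1 nz by simp
      qed
    qed
  qed
  have "(\<Sum>j<r. F (g j) * U1 $$ (a, j) * cnj (V1 $$ (b, j))) =
      (\<Sum>j<n. F (g' j) * U1 $$ (a, j) * cnj (V1 $$ (b, j)))"
    using r F0 by (intro sum.mono_neutral_cong_left) (auto simp: g'_def)
  \<comment> \<open>Insertion of U2 U2^H = 1: \<open>W\<close> expresses the columns of
    \<open>U1\<close> by those of \<open>U2\<close>.\<close>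
  also have "\<dots> = (\<Sum>j<n. \<Sum>i<m. F (g' j) * W i j * U2 $$ (a, i) * cnj (V1 $$ (b, j)))"
  proof (intro sum.cong refl)
    fix j
    have "(\<Sum>i<m. W i j * U2 $$ (a, i)) = (\<Sum>c<m. U1 $$ (c, j) * (\<Sum>i<m. U2 $$ (a, i) * cnj (U2 $$ (c, i))))"
      unfolding W_def sum_distrib_left sum_distrib_right by (subst sum.swap) (simp add: mult_ac)
    also have "\<dots> = (\<Sum>c<m. if c = a then U1 $$ (c, j) else 0)"
      using ab by (intro sum.cong refl) (simp add: mat_unitary_rows [OF U2])
    also have "\<dots> = U1 $$ (a, j)" using ab by simp
    finally have "(\<Sum>i<m. W i j * U2 $$ (a, i)) = U1 $$ (a, j)" .
    then show "F (g' j) * U1 $$ (a, j) * cnj (V1 $$ (b, j)) =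
        (\<Sum>i<m. F (g' j) * W i j * U2 $$ (a, i) * cnj (V1 $$ (b, j)))"
      by (simp add: mult.assoc flip: sum_distrib_left sum_distrib_right)
        (metis (no_types, lifting) mult.assoc sum.cong sum_distrib_right)
  qed
  also have "\<dots> = (\<Sum>j<n. \<Sum>i<m. F (h' i) * X i j * U2 $$ (a, i) * cnj (V1 $$ (b, j)))"
    by (intro sum.cong refl) (simp add: FWX)
  also have "\<dots> = (\<Sum>i<m. F (h' i) * U2 $$ (a, i) * (\<Sum>j<n. X i j * cnj (V1 $$ (b, j))))"
    by (subst sum.swap) (simp add: sum_distrib_left mult_ac)
  \<comment> \<open>Here V1 V1^H = 1 removes the sum over \<open>j\<close>.\<close>
  also have "\<dots> = (\<Sum>i<m. F (h' i) * U2 $$ (a, i) * cnj (V2 $$ (b, i)))"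
  proof (intro sum.cong refl)
    fix i
    have "(\<Sum>j<n. X i j * cnj (V1 $$ (b, j))) =
        (\<Sum>c<n. cnj (V2 $$ (c, i)) * (\<Sum>j<n. V1 $$ (c, j) * cnj (V1 $$ (b, j))))"
      unfolding X_def sum_distrib_left sum_distrib_right by (subst sum.swap) (simp add: mult_ac)
    also have "\<dots> = (\<Sum>c<n. if c = b then cnj (V2 $$ (c, i)) else 0)"
      using ab by (intro sum.cong refl) (simp add: mat_unitary_rows [OF V1])
    also have "\<dots> = cnj (V2 $$ (b, i))" using ab by simp
    finally show "F (h' i) * U2 $$ (a, i) * (\<Sum>j<n. X i j * cnj (V1 $$ (b, j))) =
        F (h' i) * U2 $$ (a, i) * cnj (V2 $$ (b, i))" by simp
  qed
  also have "\<dots> = (\<Sum>j<r. F (h j) * U2 $$ (a, j) * cnj (V2 $$ (b, j)))"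
    using r F0 by (intro sum.mono_neutral_cong_right) (auto simp: h'_def)
  finally show "svd_mat m n r U1 V1 (\<lambda>j. F (g j)) $$ (a, b) = svd_mat m n r U2 V2 (\<lambda>j. F (h j)) $$ (a, b)"
    using ab by (simp add: svd_mat_index)
qed (auto simp: svd_mat_def)

section \<open>Diagonal and truncated factors as rank-one sums\<close>

lemma mult_diagonal_adjoint_eq_svd_mat:
  assumes U: "U \<in> carrier_mat m k" and V: "V \<in> carrier_mat n l" and D: "D \<in> carrier_mat k l"
    and diag: "\<And>i j. i < k \<Longrightarrow> j < l \<Longrightarrow> i \<noteq> j \<Longrightarrow> D $$ (i, j) = 0"
  shows "U * D * mat_adjoint V = svd_mat m n (min k l) U V (\<lambda>j. D $$ (j, j))"
proof (rule eq_matI)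
  fix a b assume "a < dim_row (svd_mat m n (min k l) U V (\<lambda>j. D $$ (j, j)))"
    "b < dim_col (svd_mat m n (min k l) U V (\<lambda>j. D $$ (j, j)))"
  then have ab: "a < m" "b < n" by (auto simp: svd_mat_def)
  have UD: "(U * D) $$ (a, j) = (if j < k then U $$ (a, j) * D $$ (j, j) else 0)" if "j < l" for j
  proof -
    have "(U * D) $$ (a, j) = (\<Sum>i<k. U $$ (a, i) * D $$ (i, j))"
      using that ab by (intro mult_mat_index [OF U D]) auto
    also have "\<dots> = (\<Sum>i<k. if i = j then U $$ (a, j) * D $$ (j, j) else 0)"
      using that by (intro sum.cong refl) (auto simp: diag)
    finally show ?thesis by simp
  qed
  have "(U * D * mat_adjoint V) $$ (a, b) = (\<Sum>j<l. (U * D) $$ (a, j) * mat_adjoint V $$ (j, b))"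
    using ab by (intro mult_mat_index [OF mult_carrier_mat [OF U D] mat_adjoint_carrier [OF V]]) auto
  also have "\<dots> = (\<Sum>j<l. (if j < k then U $$ (a, j) * D $$ (j, j) else 0) * cnj (V $$ (b, j)))"
    using ab carrier_matD [OF V] by (intro sum.cong refl) (simp add: UD)
  also have "\<dots> = (\<Sum>j<min k l. D $$ (j, j) * U $$ (a, j) * cnj (V $$ (b, j)))"
    by (intro sum.mono_neutral_cong_right) auto
  finally show "(U * D * mat_adjoint V) $$ (a, b) = svd_mat m n (min k l) U V (\<lambda>j. D $$ (j, j)) $$ (a, b)"
    using ab by (simp add: svd_mat_index)
qed (use carrier_matD [OF U] carrier_matD [OF V] in \<open>auto simp: svd_mat_def\<close>)

lemma first_cols_carrier:
  assumes "U \<in> carrier_mat m k" "r \<le> k"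
  shows "first_cols r U \<in> carrier_mat m r"
  using assms by (auto simp: first_cols_def)

lemma first_cols_index:
  assumes "U \<in> carrier_mat m k" "r \<le> k" "a < m" "j < r"
  shows "first_cols r U $$ (a, j) = U $$ (a, j)"
  using assms by (auto simp: first_cols_def mat_of_cols_index)

lemma svd_mat_first_cols:
  assumes "U \<in> carrier_mat m k" "V \<in> carrier_mat n l" "r \<le> k" "r \<le> l"
  shows "svd_mat m n r (first_cols r U) (first_cols r V) g = svd_mat m n r U V g"
  using assms by (intro eq_matI) (auto simp: svd_mat_def first_cols_index)

lemma outer_prod_eq_svd_mat:
  assumes "U \<in> carrier_mat m k" "V \<in> carrier_mat n l" "r \<le> k" "r \<le> l" "j < r"
  shows "outer_prod (col U j) (col V j) = svd_mat m n r U V (\<lambda>i. if i = j then 1 else 0)"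
proof (rule eq_matI)
  fix a b assume "a < dim_row (svd_mat m n r U V (\<lambda>i. if i = j then 1 else 0))"
    "b < dim_col (svd_mat m n r U V (\<lambda>i. if i = j then 1 else 0))"
  then have ab: "a < m" "b < n" by (auto simp: svd_mat_def)
  have u: "mat_of_cols (dim_vec (col U j)) [col U j] \<in> carrier_mat m 1"
    and v: "mat_of_cols (dim_vec (col V j)) [col V j] \<in> carrier_mat n 1"
    using assms by auto
  have "outer_prod (col U j) (col V j) $$ (a, b) = U $$ (a, j) * cnj (V $$ (b, j))"
    using mult_mat_index [OF u mat_adjoint_carrier [OF v] ab] ab assms
    by (simp add: outer_prod_def mat_of_cols_index)
  also have "\<dots> = (\<Sum>i<r. if i = j then U $$ (a, i) * cnj (V $$ (b, i)) else 0)"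
    using \<open>j < r\<close> by simp
  also have "\<dots> = svd_mat m n r U V (\<lambda>i. if i = j then 1 else 0) $$ (a, b)"
    using ab unfolding svd_mat_index [OF ab] by (intro sum.cong refl) simp
  finally show "outer_prod (col U j) (col V j) $$ (a, b) =
    svd_mat m n r U V (\<lambda>i. if i = j then 1 else 0) $$ (a, b)" .
qed (use assms in \<open>auto simp: outer_prod_def svd_mat_def\<close>)

section \<open>Cauchy's integral formula for simple closed contours\<close>

text \<open>\<open>f\<close> is holomorphic on some open set around the closed region, which need
  not be simply connected; the homology forms of Cauchy's theorem and integral formula ask only that
  winding numbers vanish off that set. They do, since all points off the closed region lie outside
  the curve.\<close>

lemma has_contour_integral_cauchy_kernel:
  assumes g: "pos_simple_closed_contour g" and f: "f analytic_on on_and_inside g"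
    and c: "c \<notin> path_image g"
  shows "((\<lambda>z. f z * inverse (z - c)) has_contour_integral
    (if c \<in> inside (path_image g) then 2 * of_real pi * \<i> * f c else 0)) g"
proof -
  obtain S where S: "open S" "on_and_inside g \<subseteq> S" "f holomorphic_on S"
    using f analytic_on_holomorphic by blast
  have vp: "valid_path g" and loop: "pathfinish g = pathstart g"
    and wn: "\<And>w. w \<in> inside (path_image g) \<Longrightarrow> winding_number g w = 1"
    using g by (auto simp: pos_simple_closed_contour_def)
  have wn0: "winding_number g w = 0" if "w \<notin> on_and_inside g" for w
  proof (rule winding_number_zero_in_outside [OF valid_path_imp_path [OF vp] loop])
    show "w \<in> outside (path_image g)"
      using that inside_Un_outside [of "path_image g"] unfolding on_and_inside_def by blast
  qed
  show ?thesis
  proof (cases "c \<in> inside (path_image g)")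
    case True
    have "((\<lambda>z. f z / (z - c)) has_contour_integral (2 * pi * \<i> * winding_number g c * f c)) g"
      by (rule Cauchy_integral_formula_global [OF S(1,3)])
        (use True S(2) c vp loop wn0 in \<open>auto simp: on_and_inside_def\<close>)
    then show ?thesis using True wn by (simp add: divide_inverse)
  next
    case False
    then have c': "c \<notin> on_and_inside g" using c by (auto simp: on_and_inside_def)
    have "((\<lambda>z. f z * inverse (z - c)) has_contour_integral 0) g"
    proof (rule Cauchy_theorem_global)
      \<comment> \<open>With \<open>c\<close> outside, the kernel is holomorphic on
        \<open>S - {c}\<close>, and the deleted point also has winding number 0.\<close>
      show "open (S - {c})" using S by auto
      show "(\<lambda>z. f z * inverse (z - c)) holomorphic_on S - {c}"
        using S(3) by (intro holomorphic_intros) (auto elim: holomorphic_on_subset)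
      show "path_image g \<subseteq> S - {c}" using S(2) c by (auto simp: on_and_inside_def)
      show "winding_number g w = 0" if "w \<notin> S - {c}" for w
        using that S(2) c' by (intro wn0) auto
    qed (use vp loop in auto)
    then show ?thesis using False by simp
  qed
qed

section \<open>Tensors in singular vector form\<close>

text \<open>With \<open>Us\<close> and \<open>Vs\<close> fixed, \<open>E\<close>, \<open>A\<close>
  and \<open>z \<cdot>\<^sub>t E -\<^sub>t A\<close> all have this form, and their Moore-Penrose
  inverses have it with \<open>Us\<close> and \<open>Vs\<close> exchanged. Tensor identities thereby
  become identities of the coefficient arrays \<open>g\<close>.\<close>

definition svd_tensor :: "nat \<Rightarrow> nat \<Rightarrow> nat \<Rightarrow> nat \<Rightarrow> complex mat list \<Rightarrow> complex mat list \<Rightarrow>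
    (nat \<Rightarrow> nat \<Rightarrow> complex) \<Rightarrow> tensor" where
  "svd_tensor m n p r Us Vs g = fourier_tensor m n p (\<lambda>i. svd_mat m n r (Us ! i) (Vs ! i) (g i))"

text \<open>Each coefficient is isolated in front of a factor that depends on the vectors only, so
  that sums and integrals of coefficients pass through the entries.\<close>

lemma tentry_svd_tensor:
  assumes "k < p" "a < m" "b < n"
  shows "tentry (svd_tensor m n p r Us Vs g) k a b =
    (\<Sum>i<p. \<Sum>j<r. g i j * (dft_char p (int k * int i) * (Us ! i) $$ (a, j) * cnj ((Vs ! i) $$ (b, j)) / of_nat p))"
  using assms
  by (simp add: svd_tensor_def tentry_fourier_tensor svd_mat_index sum_distrib_left sum_divide_distrib mult_ac)

lemma svd_tensor_cong:
  "(\<And>i j. i < p \<Longrightarrow> j < r \<Longrightarrow> g i j = h i j) \<Longrightarrow> svd_tensor m n p r Us Vs g = svd_tensor m n p r Us Vs h"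
  unfolding svd_tensor_def by (intro fourier_tensor_cong svd_mat_cong)

lemma svd_tensor_in_tensors [simp]: "svd_tensor m n p r Us Vs g \<in> tensors m n p"
  by (simp add: svd_tensor_def)

lemma svd_tensor_extend:
  assumes "r \<le> q"
  shows "svd_tensor m n p r Us Vs g = svd_tensor m n p q Us Vs (\<lambda>i j. if j < r then g i j else 0)"
  unfolding svd_tensor_def by (intro fourier_tensor_cong svd_mat_extend assms)

lemma svd_tensor_mult:
  assumes "p > 0" "r \<le> n" "\<And>i. i < p \<Longrightarrow> mat_unitary n (Vs ! i)"
  shows "svd_tensor m n p r Us Vs g *\<^sub>t svd_tensor n s p r Vs Ws h =
    svd_tensor m s p r Us Ws (\<lambda>i j. g i j * h i j)"
proof -
  have "svd_tensor m n p r Us Vs g *\<^sub>t svd_tensor n s p r Vs Ws h = fourier_tensor m s p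
      (\<lambda>i. svd_mat m n r (Us ! i) (Vs ! i) (g i) * svd_mat n s r (Vs ! i) (Ws ! i) (h i))"
    unfolding svd_tensor_def by (rule tprod_fourier_tensor) (use assms in auto)
  also have "\<dots> = svd_tensor m s p r Us Ws (\<lambda>i j. g i j * h i j)"
    unfolding svd_tensor_def by (intro fourier_tensor_cong svd_mat_mult assms)
  finally show ?thesis .
qed

lemma tsmult_svd_tensor:
  "c \<cdot>\<^sub>t svd_tensor m n p r Us Vs g = svd_tensor m n p r Us Vs (\<lambda>i j. c * g i j)"
  unfolding svd_tensor_def by (subst tsmult_fourier_tensor) (auto simp: smult_svd_mat)

lemma tminus_svd_tensor:
  "svd_tensor m n p r Us Vs g -\<^sub>t svd_tensor m n p r Us Vs h = svd_tensor m n p r Us Vs (\<lambda>i j. g i j - h i j)"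
  unfolding svd_tensor_def by (subst tminus_fourier_tensor) (auto simp: minus_svd_mat)

lemma tsum_svd_tensor:
  "tsum m n p (\<lambda>x. svd_tensor m n p r Us Vs (g x)) I = svd_tensor m n p r Us Vs (\<lambda>i j. \<Sum>x\<in>I. g x i j)"
proof (rule eq_tensorI)
  fix k a b assume kab: "k < p" "a < m" "b < n"
  then have "tentry (tsum m n p (\<lambda>x. svd_tensor m n p r Us Vs (g x)) I) k a b =
      (\<Sum>x\<in>I. tentry (svd_tensor m n p r Us Vs (g x)) k a b)"
    by (simp add: tsum_def)
  also have "\<dots> = tentry (svd_tensor m n p r Us Vs (\<lambda>i j. \<Sum>x\<in>I. g x i j)) k a b"
    unfolding tentry_svd_tensor [OF kab] sum_distrib_right
    by (subst sum.swap, rule sum.cong [OF refl], rule sum.swap)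
  finally show "tentry (tsum m n p (\<lambda>x. svd_tensor m n p r Us Vs (g x)) I) k a b =
    tentry (svd_tensor m n p r Us Vs (\<lambda>i j. \<Sum>x\<in>I. g x i j)) k a b" .
qed (auto simp: tsum_def)

lemma tpinv_svd_tensor:
  assumes "p > 0" "r \<le> m" "r \<le> n"
    "\<And>i. i < p \<Longrightarrow> mat_unitary m (Us ! i)" "\<And>i. i < p \<Longrightarrow> mat_unitary n (Vs ! i)"
  shows "tpinv (svd_tensor m n p r Us Vs g) = svd_tensor n m p r Vs Us (\<lambda>i j. inverse (g i j))"
  unfolding svd_tensor_def
  by (rule tpinv_fourier_tensor) (use assms in \<open>auto intro!: svd_mat_penrose\<close>)

text \<open>Each entry is a finite linear combination of the coefficients with factors free of
  \<open>z\<close>, so integration acts on the coefficients.\<close>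

lemma svd_tensor_contour_integral:
  assumes "\<And>i j. i < p \<Longrightarrow> j < r \<Longrightarrow> ((\<lambda>z. \<phi> z i j) has_contour_integral I i j) g"
  shows "t_contour_integrable m n p (\<lambda>z. svd_tensor m n p r Us Vs (\<phi> z)) g"
    and "t_contour_integral m n p g (\<lambda>z. svd_tensor m n p r Us Vs (\<phi> z)) = svd_tensor m n p r Us Vs I"
proof -
  have *: "((\<lambda>z. tentry (svd_tensor m n p r Us Vs (\<phi> z)) k a b) has_contour_integral
      tentry (svd_tensor m n p r Us Vs I) k a b) g" if kab: "k < p" "a < m" "b < n" for k a b
    unfolding tentry_svd_tensor [OF kab]
    by (intro has_contour_integral_sum has_contour_integral_rmul assms) auto
  then show "t_contour_integrable m n p (\<lambda>z. svd_tensor m n p r Us Vs (\<phi> z)) g"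
    unfolding t_contour_integrable_def contour_integrable_on_def by blast
  show "t_contour_integral m n p g (\<lambda>z. svd_tensor m n p r Us Vs (\<phi> z)) = svd_tensor m n p r Us Vs I"
    by (rule eq_tensorI [of _ m n p])
      (auto simp: t_contour_integral_def contour_integral_unique [OF *])
qed

section \<open>T-SVD and T-CSVD\<close>

text \<open>The decompositions give Fourier blocks as \<open>map h Ds\<close>, with \<open>h\<close>
  the embedding of real matrices, a truncation of columns or the leading diagonal; full unitary
  factors are covered by \<open>id\<close>.\<close>

lemma eq_fourier_tensor_map:
  assumes p: "p > 0" and T: "T \<in> tensors m n p" and len: "length Ds = p"
    and D: "\<And>i. i < p \<Longrightarrow> h (Ds ! i) \<in> carrier_mat m n"
    and eq: "bcirc T = from_fourier m n (map h Ds)"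
  shows "T = fourier_tensor m n p (\<lambda>i. h (Ds ! i))"
proof (rule eq_fourier_tensorI [OF p T D])
  have "map h Ds = map (\<lambda>i. h (Ds ! i)) [0..<p]"
    using len by (auto intro: nth_equalityI)
  then show "bcirc T = from_fourier m n (map (\<lambda>i. h (Ds ! i)) [0..<p])" using eq by simp
qed

text \<open>The middle blocks are any diagonal \<open>D i\<close>, so that one computation serves
  both \<open>S\<close> and \<open>fhat\<close>.\<close>

lemma is_tsvd_mult:
  assumes tsvd: "is_tsvd m n p A U S V Us Ss Vs" and p: "p > 0"
    and D: "\<And>i. i < p \<Longrightarrow> D i \<in> carrier_mat m n"
      "\<And>i a b. i < p \<Longrightarrow> a < m \<Longrightarrow> b < n \<Longrightarrow> a \<noteq> b \<Longrightarrow> D i $$ (a, b) = 0"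
  shows "U *\<^sub>t fourier_tensor m n p D *\<^sub>t tadjoint V =
    svd_tensor m n p (min m n) Us Vs (\<lambda>i j. D i $$ (j, j))"
proof -
  have lens: "length Us = p" "length Vs = p"
    and U: "\<And>i. i < p \<Longrightarrow> Us ! i \<in> carrier_mat m m" and V: "\<And>i. i < p \<Longrightarrow> Vs ! i \<in> carrier_mat n n"
    and UT: "U \<in> tensors m m p" "bcirc U = from_fourier m m (map id Us)"
    and VT: "V \<in> tensors n n p" "bcirc V = from_fourier n n (map id Vs)"
    using tsvd by (auto simp: is_tsvd_def t_unitary_def intro!: mat_unitary_carrier)
  have UT': "U = fourier_tensor m m p (\<lambda>i. id (Us ! i))" and VT': "V = fourier_tensor n n p (\<lambda>i. id (Vs ! i))"
    by (rule eq_fourier_tensor_map [OF p UT(1) lens(1) _ UT(2)], use U in simp)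
      (rule eq_fourier_tensor_map [OF p VT(1) lens(2) _ VT(2)], use V in simp)
  have adj: "\<And>i. i < p \<Longrightarrow> mat_adjoint (Vs ! i) \<in> carrier_mat n n" using V by simp
  have UD: "\<And>i. i < p \<Longrightarrow> Us ! i * D i \<in> carrier_mat m n" by (rule mult_carrier_mat [OF U D(1)])
  have 1: "U *\<^sub>t fourier_tensor m n p D = fourier_tensor m n p (\<lambda>i. Us ! i * D i)"
    unfolding UT' id_apply by (rule tprod_fourier_tensor [OF p]) (rule U D(1), assumption)+
  have 2: "tadjoint V = fourier_tensor n n p (\<lambda>i. mat_adjoint (Vs ! i))"
    unfolding VT' id_apply by (rule tadjoint_fourier_tensor [OF p]) (rule V, assumption)
  have 3: "U *\<^sub>t fourier_tensor m n p D *\<^sub>t tadjoint V =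
      fourier_tensor m n p (\<lambda>i. Us ! i * D i * mat_adjoint (Vs ! i))"
    unfolding 1 2 by (rule tprod_fourier_tensor [OF p]) (rule UD adj, assumption)+
  have 4: "svd_mat m n (min m n) (Us ! i) (Vs ! i) (\<lambda>j. D i $$ (j, j)) =
      Us ! i * D i * mat_adjoint (Vs ! i)" if i: "i < p" for i
    by (rule mult_diagonal_adjoint_eq_svd_mat [OF U V D(1) D(2), symmetric]) (rule i | assumption)+
  show ?thesis
    unfolding 3 svd_tensor_def by (rule fourier_tensor_cong) (simp only: 4)
qed

lemma is_tsvd_blocks:
  assumes "is_tsvd m n p A U S V Us Ss Vs" "i < p"
  shows "Ss ! i \<in> carrier_mat m n" "a < m \<Longrightarrow> b < n \<Longrightarrow> a \<noteq> b \<Longrightarrow> (Ss ! i) $$ (a, b) = 0"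
    "j < min m n \<Longrightarrow> csv Ss i j \<ge> 0" "mat_unitary m (Us ! i)" "mat_unitary n (Vs ! i)"
proof -
  have len: "length Ss = p" "length Us = p" "length Vs = p" using assms(1) by (auto simp: is_tsvd_def)
  then have sv: "sv_mat m n (Ss ! i)" using assms by (auto simp: is_tsvd_def)
  then show C: "Ss ! i \<in> carrier_mat m n" by (simp add: sv_mat_def)
  show "a < m \<Longrightarrow> b < n \<Longrightarrow> a \<noteq> b \<Longrightarrow> (Ss ! i) $$ (a, b) = 0"
    using sv carrier_matD [OF C] by (auto simp: sv_mat_def diagonal_mat_def)
  show "j < min m n \<Longrightarrow> csv Ss i j \<ge> 0" using sv by (auto simp: sv_mat_def csv_def)
  show "mat_unitary m (Us ! i)" "mat_unitary n (Vs ! i)" using assms len by (auto simp: is_tsvd_def)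
qed

lemma is_tsvd_eq:
  assumes tsvd: "is_tsvd m n p A U S V Us Ss Vs" and p: "p > 0"
  shows "A = svd_tensor m n p (min m n) Us Vs (\<lambda>i j. of_real (csv Ss i j))"
proof -
  note blocks = is_tsvd_blocks [OF tsvd]
  have ST: "S \<in> tensors m n p" "length Ss = p" "bcirc S = from_fourier m n (map (map_mat complex_of_real) Ss)"
    and A: "A = U *\<^sub>t S *\<^sub>t tadjoint V"
    using tsvd unfolding is_tsvd_def by blast+
  have "S = fourier_tensor m n p (\<lambda>i. map_mat complex_of_real (Ss ! i))"
    by (rule eq_fourier_tensor_map [OF p ST(1,2) _ ST(3)]) (use blocks in auto)
  moreover have C: "map_mat complex_of_real (Ss ! i) \<in> carrier_mat m n" if "i < p" for i
    using blocks(1) [OF that] by simp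
  moreover have "map_mat complex_of_real (Ss ! i) $$ (a, b) = 0" if "i < p" "a < m" "b < n" "a \<noteq> b" for i a b
    using that carrier_matD [OF blocks(1) [OF that(1)]] blocks(2) [OF that] by simp
  ultimately have "A = svd_tensor m n p (min m n) Us Vs (\<lambda>i j. map_mat complex_of_real (Ss ! i) $$ (j, j))"
    using A is_tsvd_mult [OF tsvd p C] by simp
  also have "\<dots> = svd_tensor m n p (min m n) Us Vs (\<lambda>i j. of_real (csv Ss i j))"
    using carrier_matD [OF blocks(1)] by (intro svd_tensor_cong) (auto simp: csv_def)
  finally show ?thesis .
qed

lemma is_tsvd_fhat:
  assumes tsvd: "is_tsvd m n p A U S V Us Ss Vs" and p: "p > 0"
  shows "U *\<^sub>t fhat m n f Ss *\<^sub>t tadjoint V = svd_tensor m n p (min m n) Us Vs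
    (\<lambda>i j. if csv Ss i j > 0 then f (of_real (csv Ss i j)) else 0)"
proof -
  note blocks = is_tsvd_blocks [OF tsvd]
  have len: "length Ss = p" using tsvd by (simp add: is_tsvd_def)
  have C: "ftilde f (Ss ! i) \<in> carrier_mat m n" if "i < p" for i
    using blocks(1) [OF that] by (auto simp: ftilde_def)
  have "map (ftilde f) Ss = map (\<lambda>i. ftilde f (Ss ! i)) [0..<p]"
    using len by (auto intro: nth_equalityI)
  then have "fhat m n f Ss = fourier_tensor m n p (\<lambda>i. ftilde f (Ss ! i))"
    using len bcirc_inv_from_fourier [OF p C] by (simp add: fhat_def)
  moreover have "ftilde f (Ss ! i) $$ (a, b) = 0" if "i < p" "a < m" "b < n" "a \<noteq> b" for i a b
    using that carrier_matD [OF blocks(1) [OF that(1)]] by (simp add: ftilde_def)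
  ultimately have "U *\<^sub>t fhat m n f Ss *\<^sub>t tadjoint V =
      svd_tensor m n p (min m n) Us Vs (\<lambda>i j. ftilde f (Ss ! i) $$ (j, j))"
    using is_tsvd_mult [OF tsvd p C] by simp
  also have "\<dots> = svd_tensor m n p (min m n) Us Vs
      (\<lambda>i j. if csv Ss i j > 0 then f (of_real (csv Ss i j)) else 0)"
    using carrier_matD [OF blocks(1)] by (intro svd_tensor_cong) (auto simp: csv_def ftilde_def)
  finally show ?thesis .
qed

text \<open>The definite description is resolved by uniqueness: two T-SVDs of \<open>A\<close>
  expand the same Fourier blocks, and \<open>svd_mat_map_unique\<close> carries this equality over
  to the function values.\<close>

lemma gen_tensor_fun_eq:
  assumes tsvd: "is_tsvd m n p A U S V Us Ss Vs" and p: "p > 0"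
  shows "gen_tensor_fun f A = svd_tensor m n p (min m n) Us Vs
    (\<lambda>i j. if csv Ss i j > 0 then f (of_real (csv Ss i j)) else 0)"
proof -
  \<comment> \<open>The cut-off at 0 is that of \<open>ftilde\<close>; it gives
    \<open>F 0 = 0\<close> whatever \<open>f 0\<close> is.\<close>
  define F where "F = (\<lambda>x::real. if x > 0 then f (of_real x) else 0)"
  have A: "A \<in> tensors m n p" using tsvd unfolding is_tsvd_def by blast
  have fhat: "U *\<^sub>t fhat m n f Ss *\<^sub>t tadjoint V = svd_tensor m n p (min m n) Us Vs (\<lambda>i j. F (csv Ss i j))"
    if "is_tsvd m n p A U S V Us Ss Vs" for U S V Us Ss Vs
    unfolding F_def by (rule is_tsvd_fhat [OF that p])
  have "(THE B. \<exists>U S V Us Ss Vs. is_tsvd m n p A U S V Us Ss Vs \<and> B = U *\<^sub>t fhat m n f Ss *\<^sub>t tadjoint V) =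
    svd_tensor m n p (min m n) Us Vs (\<lambda>i j. F (csv Ss i j))"
  proof (rule the_equality)
    show "\<exists>U S V Us' Ss' Vs'. is_tsvd m n p A U S V Us' Ss' Vs' \<and>
        svd_tensor m n p (min m n) Us Vs (\<lambda>i j. F (csv Ss i j)) = U *\<^sub>t fhat m n f Ss' *\<^sub>t tadjoint V"
      by (intro exI conjI, rule tsvd, rule fhat [OF tsvd, symmetric])
    fix B assume "\<exists>U S V Us Ss Vs. is_tsvd m n p A U S V Us Ss Vs \<and> B = U *\<^sub>t fhat m n f Ss *\<^sub>t tadjoint V"
    then obtain U' S' V' Us' Ss' Vs' where tsvd': "is_tsvd m n p A U' S' V' Us' Ss' Vs'"
      and B: "B = U' *\<^sub>t fhat m n f Ss' *\<^sub>t tadjoint V'"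
      by (elim exE conjE)
    let ?D = "\<lambda>Us Ss Vs i. svd_mat m n (min m n) (Us ! i) (Vs ! i) (\<lambda>j. complex_of_real (csv Ss i j))"
    have eq: "fourier_tensor m n p (?D Us' Ss' Vs') = fourier_tensor m n p (?D Us Ss Vs)"
      using is_tsvd_eq [OF tsvd p] is_tsvd_eq [OF tsvd' p] unfolding svd_tensor_def by simp
    show "B = svd_tensor m n p (min m n) Us Vs (\<lambda>i j. F (csv Ss i j))"
      unfolding B fhat [OF tsvd'] svd_tensor_def
    proof (rule fourier_tensor_cong)
      fix i assume i: "i < p"
      note bl = is_tsvd_blocks [OF tsvd i] and bl' = is_tsvd_blocks [OF tsvd' i]
      have eq_i: "?D Us' Ss' Vs' i = ?D Us Ss Vs i"
        by (rule fourier_tensor_inject [OF p _ _ eq i]) (rule svd_mat_carrier)+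
      have F0: "F 0 = 0" by (simp add: F_def)
      show "svd_mat m n (min m n) (Us' ! i) (Vs' ! i) (\<lambda>j. F (csv Ss' i j)) =
          svd_mat m n (min m n) (Us ! i) (Vs ! i) (\<lambda>j. F (csv Ss i j))"
        by (rule svd_mat_map_unique [where g = "csv Ss' i" and h = "csv Ss i" and F = F,
              OF bl'(4,5) bl(4,5) min.cobounded1 min.cobounded2 _ _ eq_i F0])
          (rule bl'(3) bl(3), assumption)+
    qed
  qed
  then show ?thesis
    using tensors_dims [OF A] p by (simp add: gen_tensor_fun_def F_def)
qed

section \<open>Tubal rank and the truncated expansion\<close>

lemma (in vec_space) rank_le_nr:
  assumes A: "A \<in> carrier_mat n nc"
  shows "rank A \<le> n"
proof -
  have cols: "set (cols A) \<subseteq> carrier_vec n" using A cols_dim by blast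
  obtain S where S: "maximal S (\<lambda>T. T \<subseteq> set (cols A) \<and> lin_indpt T)"
    using maximal_exists [of "(\<lambda>T. T \<subseteq> set (cols A) \<and> lin_indpt T)" "card (set (cols A))" "{}"]
    by (meson List.finite_set card_mono empty_iff empty_subsetI finite_lin_indpt2 rev_finite_subset)
  then have "S \<subseteq> carrier V" "lin_indpt S" using cols by (auto simp: maximal_def)
  then have "card S \<le> n" using li_le_dim(2) [OF fin_dim] dim_is_n by simp
  then show ?thesis using rank_card_indpt [OF A S] by simp
qed

text \<open>A maximum over a nonempty finite set is attained, so \<open>r\<close> is the rank of one
  m by n block. The bounds ensure that the unitary factors have at least \<open>r\<close>
  columns.\<close>

lemma is_tcsvd_rank_le:
  assumes tcsvd: "is_tcsvd m n p A r Ur Sr Vr Us Ss Vs" and p: "p > 0"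
  shows "r \<le> m" "r \<le> n"
proof -
  obtain U S V where tsvd: "is_tsvd m n p A U S V Us Ss Vs" and r: "r = tubal_rank m Ss"
    using tcsvd unfolding is_tcsvd_def by blast
  have len: "length Ss = p" using tsvd unfolding is_tsvd_def by blast
  have "vec_space.rank m D \<le> m \<and> vec_space.rank m D \<le> n" if D: "D \<in> set Ss" for D
  proof -
    obtain i where "i < p" "D = Ss ! i" using D len by (auto simp: in_set_conv_nth)
    then have C: "D \<in> carrier_mat m n" by (simp add: is_tsvd_blocks(1) [OF tsvd])
    show ?thesis by (rule conjI [OF vec_space.rank_le_nr [OF C] vec_space.rank_le_nc [OF C]])
  qed
  moreover have "r \<in> vec_space.rank m ` set Ss"
    unfolding r tubal_rank_def using len p by (intro Max_in) auto
  ultimately show "r \<le> m" "r \<le> n" by auto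
qed

lemma is_tcsvd_eq:
  assumes tcsvd: "is_tcsvd m n p A r Ur Sr Vr Us Ss Vs" and p: "p > 0"
  shows "A = svd_tensor m n p r Us Vs (\<lambda>i j. of_real (csv Ss i j))"
    and "Ur *\<^sub>t tadjoint Vr = svd_tensor m n p r Us Vs (\<lambda>i j. 1)"
proof -
  note r = is_tcsvd_rank_le [OF tcsvd p]
  obtain U S V where tsvd: "is_tsvd m n p A U S V Us Ss Vs"
    using tcsvd unfolding is_tcsvd_def by blast
  have len: "length Us = p" "length Ss = p" "length Vs = p"
    using tsvd unfolding is_tsvd_def by blast+
  have UT: "Ur \<in> tensors m r p" "bcirc Ur = from_fourier m r (map (first_cols r) Us)"
    and ST: "Sr \<in> tensors r r p" "bcirc Sr = from_fourier r r (map (leading_diag r) Ss)"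
    and VT: "Vr \<in> tensors n r p" "bcirc Vr = from_fourier n r (map (first_cols r) Vs)"
    and A: "A = Ur *\<^sub>t Sr *\<^sub>t tadjoint Vr"
    using tcsvd unfolding is_tcsvd_def by blast+
  have U: "Us ! i \<in> carrier_mat m m" and V: "Vs ! i \<in> carrier_mat n n" if "i < p" for i
    using is_tsvd_blocks(4,5) [OF tsvd that] by (auto intro: mat_unitary_carrier)
  have Uc: "first_cols r (Us ! i) \<in> carrier_mat m r" and Vc: "first_cols r (Vs ! i) \<in> carrier_mat n r"
    and Vc': "mat_adjoint (first_cols r (Vs ! i)) \<in> carrier_mat r n" if "i < p" for i
    using first_cols_carrier [OF U [OF that] r(1)] first_cols_carrier [OF V [OF that] r(2)] by auto
  have Sc: "leading_diag r (Ss ! i) \<in> carrier_mat r r" for i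
    by (auto simp: leading_diag_def mat_diag_def)
  have Uf: "Ur = fourier_tensor m r p (\<lambda>i. first_cols r (Us ! i))"
    by (rule eq_fourier_tensor_map [OF p UT(1) len(1) _ UT(2)]) (rule Uc)
  have Vf: "Vr = fourier_tensor n r p (\<lambda>i. first_cols r (Vs ! i))"
    by (rule eq_fourier_tensor_map [OF p VT(1) len(3) _ VT(2)]) (rule Vc)
  have Sf: "Sr = fourier_tensor r r p (\<lambda>i. leading_diag r (Ss ! i))"
    by (rule eq_fourier_tensor_map [OF p ST(1) len(2) _ ST(2)]) (rule Sc)
  have Va: "tadjoint Vr = fourier_tensor r n p (\<lambda>i. mat_adjoint (first_cols r (Vs ! i)))"
    unfolding Vf by (rule tadjoint_fourier_tensor [OF p]) (rule Vc)
  have US: "Ur *\<^sub>t Sr = fourier_tensor m r p (\<lambda>i. first_cols r (Us ! i) * leading_diag r (Ss ! i))"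
    unfolding Uf Sf by (rule tprod_fourier_tensor [OF p]) (rule Uc Sc, assumption?)+
  have block: "first_cols r (Us ! i) * D * mat_adjoint (first_cols r (Vs ! i)) =
      svd_mat m n r (Us ! i) (Vs ! i) (\<lambda>j. D $$ (j, j))"
    if i: "i < p" and D: "D \<in> carrier_mat r r" "\<And>a b. a < r \<Longrightarrow> b < r \<Longrightarrow> a \<noteq> b \<Longrightarrow> D $$ (a, b) = 0" for i D
    using mult_diagonal_adjoint_eq_svd_mat [OF Uc [OF i] Vc [OF i] D]
    by (simp add: svd_mat_first_cols [OF U [OF i] V [OF i] r])
  show "A = svd_tensor m n p r Us Vs (\<lambda>i j. of_real (csv Ss i j))"
  proof -
    have "A = fourier_tensor m n p (\<lambda>i. first_cols r (Us ! i) * leading_diag r (Ss ! i) *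
        mat_adjoint (first_cols r (Vs ! i)))"
      unfolding A US Va by (rule tprod_fourier_tensor [OF p]) (rule mult_carrier_mat [OF Uc Sc] Vc', assumption)+
    also have "\<dots> = svd_tensor m n p r Us Vs (\<lambda>i j. of_real (csv Ss i j))"
      unfolding svd_tensor_def
    proof (rule fourier_tensor_cong)
      fix i assume i: "i < p"
      have "first_cols r (Us ! i) * leading_diag r (Ss ! i) * mat_adjoint (first_cols r (Vs ! i)) =
          svd_mat m n r (Us ! i) (Vs ! i) (\<lambda>j. leading_diag r (Ss ! i) $$ (j, j))"
        by (rule block [OF i Sc]) (auto simp: leading_diag_def mat_diag_def)
      also have "\<dots> = svd_mat m n r (Us ! i) (Vs ! i) (\<lambda>j. of_real (csv Ss i j))"
        by (rule svd_mat_cong) (auto simp: leading_diag_def mat_diag_def csv_def)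
      finally show "first_cols r (Us ! i) * leading_diag r (Ss ! i) * mat_adjoint (first_cols r (Vs ! i)) =
          svd_mat m n r (Us ! i) (Vs ! i) (\<lambda>j. of_real (csv Ss i j))" .
    qed
    finally show ?thesis .
  qed
  show "Ur *\<^sub>t tadjoint Vr = svd_tensor m n p r Us Vs (\<lambda>i j. 1)"
  proof -
    have "Ur *\<^sub>t tadjoint Vr = fourier_tensor m n p (\<lambda>i. first_cols r (Us ! i) * mat_adjoint (first_cols r (Vs ! i)))"
      unfolding Va unfolding Uf by (rule tprod_fourier_tensor [OF p]) (rule Uc Vc', assumption)+
    also have "\<dots> = svd_tensor m n p r Us Vs (\<lambda>i j. 1)"
      unfolding svd_tensor_def
    proof (rule fourier_tensor_cong)
      fix i assume i: "i < p"
      \<comment> \<open>An identity block is inserted so that \<open>E\<close> is treated like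
        \<open>A\<close> with all coefficients 1.\<close>
      have "first_cols r (Us ! i) * mat_adjoint (first_cols r (Vs ! i)) =
          first_cols r (Us ! i) * 1\<^sub>m r * mat_adjoint (first_cols r (Vs ! i))"
        using Uc [OF i] by simp
      also have "\<dots> = svd_mat m n r (Us ! i) (Vs ! i) (\<lambda>j. 1\<^sub>m r $$ (j, j))"
        by (rule block [OF i]) auto
      also have "\<dots> = svd_mat m n r (Us ! i) (Vs ! i) (\<lambda>j. 1)"
        by (rule svd_mat_cong) simp
      finally show "first_cols r (Us ! i) * mat_adjoint (first_cols r (Vs ! i)) =
          svd_mat m n r (Us ! i) (Vs ! i) (\<lambda>j. 1)" .
    qed
    finally show ?thesis .
  qed
qed

text \<open>
  That the singular values beyond the tubal rank vanish is read off the two expansions of \<open>A\<close>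
  instead of the rank.
\<close>
lemma is_tcsvd_csv_eq_0:
  assumes tcsvd: "is_tcsvd m n p A r Ur Sr Vr Us Ss Vs" and i: "i < p" and j: "r \<le> j" "j < min m n"
  shows "csv Ss i j = 0"
proof -
  have p: "p > 0" using i by simp
  note r = is_tcsvd_rank_le [OF tcsvd p]
  obtain U S V where tsvd: "is_tsvd m n p A U S V Us Ss Vs"
    using tcsvd unfolding is_tcsvd_def by blast
  let ?D = "\<lambda>q i. svd_mat m n q (Us ! i) (Vs ! i) (\<lambda>j. complex_of_real (csv Ss i j))"
  have eq: "fourier_tensor m n p (?D r) = fourier_tensor m n p (?D (min m n))"
    using is_tcsvd_eq(1) [OF tcsvd p] is_tsvd_eq [OF tsvd p] unfolding svd_tensor_def by simp
  have "?D r i = ?D (min m n) i"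
    by (rule fourier_tensor_inject [OF p _ _ eq i]) (rule svd_mat_carrier)+
  \<comment> \<open>Padding brings the truncated expansion to the length of the full one, so that
    coefficients can be compared.\<close>
  moreover have "?D r i = svd_mat m n (min m n) (Us ! i) (Vs ! i)
      (\<lambda>j. if j < r then complex_of_real (csv Ss i j) else 0)"
    using r by (intro svd_mat_extend) simp
  ultimately have "svd_mat m n (min m n) (Us ! i) (Vs ! i) (\<lambda>j. complex_of_real (csv Ss i j)) =
      svd_mat m n (min m n) (Us ! i) (Vs ! i) (\<lambda>j. if j < r then complex_of_real (csv Ss i j) else 0)"
    by simp
  from svd_mat_inject [OF is_tsvd_blocks(4,5) [OF tsvd i] _ _ this j(2)] j
  show ?thesis by simp
qed

section \<open>Partial isometry tensors as coefficient arrays\<close>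

lemma iso_tensor_eq_svd_tensor:
  assumes p: "p > 0" and len: "length Us = p" and U: "\<And>k. k < p \<Longrightarrow> Us ! k \<in> carrier_mat m m"
    and V: "\<And>k. k < p \<Longrightarrow> Vs ! k \<in> carrier_mat n n" and r: "r \<le> m" "r \<le> n" and i: "i < p" and j: "j < r"
  shows "iso_tensor m n Us Vs i j = svd_tensor m n p r Us Vs (\<lambda>k l. if k = i \<and> l = j then 1 else 0)"
proof -
  let ?D = "\<lambda>k. if k = i then outer_prod (col (Us ! i) j) (col (Vs ! i) j) else 0\<^sub>m m n"
  have D: "?D k = svd_mat m n r (Us ! k) (Vs ! k) (\<lambda>l. if k = i \<and> l = j then 1 else 0)" if "k < p" for k
  proof (cases "k = i")
    case True
    then show ?thesis using outer_prod_eq_svd_mat [OF U [OF i] V [OF i] r j] by simp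
  next
    case False
    then show ?thesis by (intro eq_matI) (auto simp: svd_mat_def)
  qed
  have "iso_tensor m n Us Vs i j = fourier_tensor m n p ?D"
    unfolding iso_tensor_def len
  proof (rule bcirc_inv_from_fourier [OF p])
    show "?D k \<in> carrier_mat m n" if "k < p" for k
      unfolding D [OF that] by (rule svd_mat_carrier)
  qed
  also have "\<dots> = svd_tensor m n p r Us Vs (\<lambda>k l. if k = i \<and> l = j then 1 else 0)"
    unfolding svd_tensor_def by (rule fourier_tensor_cong) (rule D)
  finally show ?thesis .
qed

text \<open>Each summand has the indicator of a single index pair as coefficient array; over the
  level set of \<open>\<gamma>\<close> these add up to the indicator of that set.\<close>

lemma iso_tensor_at_eq_svd_tensor:
  assumes p: "p > 0" and len: "length Us = p" and U: "\<And>k. k < p \<Longrightarrow> Us ! k \<in> carrier_mat m m"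
    and V: "\<And>k. k < p \<Longrightarrow> Vs ! k \<in> carrier_mat n n" and r: "r \<le> m" "r \<le> n"
  shows "iso_tensor_at m n r Us Ss Vs \<gamma> =
    svd_tensor m n p r Us Vs (\<lambda>i j. if csv Ss i j = \<gamma> then 1 else 0)"
proof -
  let ?I = "{(i, j). i < p \<and> j < r \<and> csv Ss i j = \<gamma>}"
  have fin: "finite ?I" by (rule finite_subset [of _ "{..<p} \<times> {..<r}"]) auto
  have "iso_tensor_at m n r Us Ss Vs \<gamma> = tsum m n p (\<lambda>(i, j). iso_tensor m n Us Vs i j) ?I"
    by (simp add: iso_tensor_at_def len)
  also have "\<dots> = tsum m n p (\<lambda>x. svd_tensor m n p r Us Vs (\<lambda>k l. if k = fst x \<and> l = snd x then 1 else 0)) ?I"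
    unfolding tsum_def
    by (intro arg_cong [where f = "mk_tensor m n p"] ext sum.cong refl)
      (auto simp: iso_tensor_eq_svd_tensor [OF p len U V r])
  also have "\<dots> = svd_tensor m n p r Us Vs (\<lambda>k l. \<Sum>x\<in>?I. if k = fst x \<and> l = snd x then 1 else 0)"
    by (rule tsum_svd_tensor)
  also have "\<dots> = svd_tensor m n p r Us Vs (\<lambda>i j. if csv Ss i j = \<gamma> then 1 else 0)"
  proof (rule svd_tensor_cong)
    fix k l assume "k < p" "l < r"
    have "(\<Sum>x\<in>?I. if k = fst x \<and> l = snd x then 1 else 0 :: complex) = (\<Sum>x\<in>?I. if (k, l) = x then 1 else 0)"
      by (intro sum.cong refl) (simp add: prod_eq_iff)
    also have "\<dots> = (if csv Ss k l = \<gamma> then 1 else 0)"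
      using fin \<open>k < p\<close> \<open>l < r\<close> by simp
    finally show "(\<Sum>x\<in>?I. if k = fst x \<and> l = snd x then 1 else 0 :: complex) =
      (if csv Ss k l = \<gamma> then 1 else 0)" .
  qed
  finally show ?thesis .
qed

section \<open>Contour integrals of the Moore-Penrose inverse\<close>

theorem theorem3:
  fixes m n p r :: nat
    and A Ur Sr Vr E :: tensor
    and Us Vs :: "complex mat list" and Ss :: "real mat list"
    and \<Gamma> :: "real \<Rightarrow> real \<Rightarrow> complex"
    and f :: "complex \<Rightarrow> complex"
  assumes A: "A \<in> tensors m n p" "real_tensor A" "A \<noteq> tzero m n p"
    and tcsvd: "is_tcsvd m n p A r Ur Sr Vr Us Ss Vs"
    and E: "E = Ur *\<^sub>t tadjoint Vr"
    and contour: "\<And>\<gamma>. \<gamma> \<in> csv_set r Ss \<Longrightarrow> pos_simple_closed_contour (\<Gamma> \<gamma>)"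
    and own: "\<And>\<gamma>. \<gamma> \<in> csv_set r Ss \<Longrightarrow> complex_of_real \<gamma> \<in> inside (path_image (\<Gamma> \<gamma>))"
    and others: "\<And>\<gamma> \<gamma>'. \<gamma> \<in> csv_set r Ss \<Longrightarrow> \<gamma>' \<in> csv_set r Ss \<Longrightarrow> \<gamma>' \<noteq> \<gamma> \<Longrightarrow>
                   complex_of_real \<gamma>' \<notin> on_and_inside (\<Gamma> \<gamma>)"
    and f_analytic: "\<And>\<gamma>. \<gamma> \<in> csv_set r Ss \<Longrightarrow> f analytic_on on_and_inside (\<Gamma> \<gamma>)"
    and f_zero: "0 \<in> csv_set r Ss \<Longrightarrow> f 0 = 0"
  shows
    "(\<forall>\<gamma> \<in> csv_set r Ss.
        t_contour_integrable n m p (\<lambda>z. tpinv (z \<cdot>\<^sub>t E -\<^sub>t A)) (\<Gamma> \<gamma>) \<and>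
        iso_tensor_at m n r Us Ss Vs \<gamma> =
          E *\<^sub>t (1 / (2 * of_real pi * \<i>) \<cdot>\<^sub>t
            t_contour_integral n m p (\<Gamma> \<gamma>) (\<lambda>z. tpinv (z \<cdot>\<^sub>t E -\<^sub>t A))) *\<^sub>t E)
     \<and>
     ((\<forall>\<gamma> \<in> csv_set r Ss.
        t_contour_integrable n m p (\<lambda>z. f z \<cdot>\<^sub>t tpinv (z \<cdot>\<^sub>t E -\<^sub>t A)) (\<Gamma> \<gamma>)) \<and>
     gen_tensor_fun f A =
        E *\<^sub>t (1 / (2 * of_real pi * \<i>) \<cdot>\<^sub>t
          t_contour_integral_family n m p \<Gamma> (csv_set r Ss)
            (\<lambda>z. f z \<cdot>\<^sub>t tpinv (z \<cdot>\<^sub>t E -\<^sub>t A))) *\<^sub>t E)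
     \<and>
     (0 \<notin> csv_set r Ss \<and>
      (\<forall>\<gamma> \<in> csv_set r Ss. (\<lambda>z. 1 / z) analytic_on on_and_inside (\<Gamma> \<gamma>)) \<longrightarrow>
     (\<forall>\<gamma> \<in> csv_set r Ss.
        t_contour_integrable n m p (\<lambda>z. 1 / z \<cdot>\<^sub>t tpinv (z \<cdot>\<^sub>t E -\<^sub>t A)) (\<Gamma> \<gamma>)) \<and>
     tpinv A =
        1 / (2 * of_real pi * \<i>) \<cdot>\<^sub>t
          t_contour_integral_family n m p \<Gamma> (csv_set r Ss)
            (\<lambda>z. 1 / z \<cdot>\<^sub>t tpinv (z \<cdot>\<^sub>t E -\<^sub>t A)))"
proof -
  obtain U S V where tsvd: "is_tsvd m n p A U S V Us Ss Vs"
    using tcsvd unfolding is_tcsvd_def by blast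
  \<comment> \<open>For \<open>p = 0\<close> the empty list is the only tensor and equals
    \<open>tzero m n p\<close>, which is excluded.\<close>
  have p: "p > 0"
  proof (rule ccontr)
    assume "\<not> p > 0"
    then have "A = tzero m n p" using tensors_dims(1) [OF A(1)] by (simp add: tzero_def)
    then show False using A(3) by simp
  qed
  note r = is_tcsvd_rank_le [OF tcsvd p]
  have lens: "length Us = p" "length Ss = p" "length Vs = p"
    using tsvd unfolding is_tsvd_def by blast+
  have unit: "mat_unitary m (Us ! i)" "mat_unitary n (Vs ! i)" if "i < p" for i
    using is_tsvd_blocks(4,5) [OF tsvd that] .
  let ?T = "svd_tensor m n p r Us Vs" and ?T' = "svd_tensor n m p r Vs Us"
  let ?c = "\<lambda>i j. complex_of_real (csv Ss i j)"
  let ?k = "2 * of_real pi * \<i> :: complex"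
  note A_eq = is_tcsvd_eq(1) [OF tcsvd p]
  have E_eq: "E = ?T (\<lambda>i j. 1)" unfolding E by (rule is_tcsvd_eq(2) [OF tcsvd p])
  have in_csv: "csv Ss i j \<in> csv_set r Ss" if "i < p" "j < r" for i j
    using that lens by (auto simp: csv_set_def)
  have fin: "finite (csv_set r Ss)"
    by (rule finite_subset [of _ "(\<lambda>(i, j). csv Ss i j) ` ({..<p} \<times> {..<r})"])
      (auto simp: csv_set_def lens)
  \<comment> \<open>Valid for every \<open>z\<close>: a term whose value equals \<open>z\<close>
    drops out of the difference and has coefficient \<open>inverse 0 = 0\<close> on the
    right.\<close>
  have pinv: "tpinv (z \<cdot>\<^sub>t E -\<^sub>t A) = ?T' (\<lambda>i j. inverse (z - ?c i j))" for z
    unfolding E_eq A_eq tsmult_svd_tensor tminus_svd_tensor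
    using tpinv_svd_tensor [where g = "\<lambda>i j. z * 1 - ?c i j", OF p r unit] by simp
  \<comment> \<open>Every coefficient is itself one of the distinct values, so it is either the
    \<open>\<gamma>\<close> enclosed by the contour or lies off the closed region.\<close>
  have kernel: "((\<lambda>z. h z * inverse (z - ?c i j)) has_contour_integral
      (if csv Ss i j = \<gamma> then ?k * h (?c i j) else 0)) (\<Gamma> \<gamma>)"
    if \<gamma>: "\<gamma> \<in> csv_set r Ss" and h: "h analytic_on on_and_inside (\<Gamma> \<gamma>)" and ij: "i < p" "j < r" for h \<gamma> i j
  proof -
    have "?c i j \<notin> path_image (\<Gamma> \<gamma>) \<and> (?c i j \<in> inside (path_image (\<Gamma> \<gamma>)) \<longleftrightarrow> csv Ss i j = \<gamma>)"
      using own [OF \<gamma>] others [OF \<gamma> in_csv [OF ij]] inside_no_overlap [of "path_image (\<Gamma> \<gamma>)"]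
      unfolding on_and_inside_def by blast
    then show ?thesis
      using has_contour_integral_cauchy_kernel [OF contour [OF \<gamma>] h, of "?c i j"] by simp
  qed
  \<comment> \<open>Stated for general \<open>h\<close>; the instances are the constant 1,
    \<open>f\<close> and 1/z.\<close>
  have integral: "t_contour_integrable n m p (\<lambda>z. h z \<cdot>\<^sub>t tpinv (z \<cdot>\<^sub>t E -\<^sub>t A)) (\<Gamma> \<gamma>)"
    "t_contour_integral n m p (\<Gamma> \<gamma>) (\<lambda>z. h z \<cdot>\<^sub>t tpinv (z \<cdot>\<^sub>t E -\<^sub>t A)) =
      ?T' (\<lambda>i j. if csv Ss i j = \<gamma> then ?k * h (?c i j) else 0)"
    if "\<gamma> \<in> csv_set r Ss" "h analytic_on on_and_inside (\<Gamma> \<gamma>)" for h \<gamma>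
    unfolding pinv tsmult_svd_tensor
    by (rule svd_tensor_contour_integral; rule kernel [OF that]; assumption)+
  \<comment> \<open>Each coefficient is enclosed by exactly one contour of the family, so the sum
    over the contours has a single nonzero candidate per index pair.\<close>
  have family: "1 / ?k \<cdot>\<^sub>t t_contour_integral_family n m p \<Gamma> (csv_set r Ss) (\<lambda>z. h z \<cdot>\<^sub>t tpinv (z \<cdot>\<^sub>t E -\<^sub>t A)) =
      ?T' (\<lambda>i j. h (?c i j))"
    if h: "\<And>\<gamma>. \<gamma> \<in> csv_set r Ss \<Longrightarrow> h analytic_on on_and_inside (\<Gamma> \<gamma>)" for h
  proof -
    have "t_contour_integral_family n m p \<Gamma> (csv_set r Ss) (\<lambda>z. h z \<cdot>\<^sub>t tpinv (z \<cdot>\<^sub>t E -\<^sub>t A)) =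
        tsum n m p (\<lambda>\<gamma>. ?T' (\<lambda>i j. if csv Ss i j = \<gamma> then ?k * h (?c i j) else 0)) (csv_set r Ss)"
      unfolding t_contour_integral_family_def tsum_def
      by (intro arg_cong [where f = "mk_tensor n m p"] ext sum.cong refl) (simp add: integral(2) h)
    also have "\<dots> = ?T' (\<lambda>i j. \<Sum>\<gamma>\<in>csv_set r Ss. if csv Ss i j = \<gamma> then ?k * h (?c i j) else 0)"
      by (rule tsum_svd_tensor)
    also have "\<dots> = ?T' (\<lambda>i j. ?k * h (?c i j))"
      using fin in_csv by (intro svd_tensor_cong) simp
    finally show ?thesis by (simp add: tsmult_svd_tensor)
  qed
  \<comment> \<open>All coefficients of \<open>E\<close> are 1, so the array \<open>g\<close> is
    unchanged.\<close>
  have sandwich: "E *\<^sub>t ?T' g *\<^sub>t E = ?T g" for g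
    unfolding E_eq using svd_tensor_mult [OF p r(2) unit(2)] svd_tensor_mult [OF p r(1) unit(1)] by simp
  have part1: "t_contour_integrable n m p (\<lambda>z. tpinv (z \<cdot>\<^sub>t E -\<^sub>t A)) (\<Gamma> \<gamma>) \<and>
      iso_tensor_at m n r Us Ss Vs \<gamma> = E *\<^sub>t (1 / ?k \<cdot>\<^sub>t
        t_contour_integral n m p (\<Gamma> \<gamma>) (\<lambda>z. tpinv (z \<cdot>\<^sub>t E -\<^sub>t A))) *\<^sub>t E"
    if \<gamma>: "\<gamma> \<in> csv_set r Ss" for \<gamma>
  proof -
    have one: "(\<lambda>z. 1 \<cdot>\<^sub>t tpinv (z \<cdot>\<^sub>t E -\<^sub>t A)) = (\<lambda>z. tpinv (z \<cdot>\<^sub>t E -\<^sub>t A))"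
      unfolding pinv tsmult_svd_tensor by simp
    note int = integral [OF \<gamma>, of "\<lambda>z. 1", unfolded one, OF analytic_on_const]
    have "iso_tensor_at m n r Us Ss Vs \<gamma> = ?T (\<lambda>i j. if csv Ss i j = \<gamma> then 1 else 0)"
      by (rule iso_tensor_at_eq_svd_tensor [OF p lens(1) _ _ r]) (rule mat_unitary_carrier unit, assumption?)+
    also have "\<dots> = E *\<^sub>t (1 / ?k \<cdot>\<^sub>t ?T' (\<lambda>i j. if csv Ss i j = \<gamma> then ?k * 1 else 0)) *\<^sub>t E"
      unfolding tsmult_svd_tensor sandwich by (rule svd_tensor_cong) simp
    finally show ?thesis using int by simp
  qed
  have part2: "gen_tensor_fun f A = E *\<^sub>t (1 / ?k \<cdot>\<^sub>t
      t_contour_integral_family n m p \<Gamma> (csv_set r Ss) (\<lambda>z. f z \<cdot>\<^sub>t tpinv (z \<cdot>\<^sub>t E -\<^sub>t A))) *\<^sub>t E"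
  proof -
    have "gen_tensor_fun f A = svd_tensor m n p (min m n) Us Vs (\<lambda>i j. if csv Ss i j > 0 then f (?c i j) else 0)"
      by (rule gen_tensor_fun_eq [OF tsvd p])
    also have "\<dots> = svd_tensor m n p (min m n) Us Vs (\<lambda>i j. if j < r then f (?c i j) else 0)"
    proof (rule svd_tensor_cong)
      fix i j assume i: "i < p" and j: "j < min m n"
      show "(if csv Ss i j > 0 then f (?c i j) else 0) = (if j < r then f (?c i j) else 0)"
      proof (cases "j < r")
        case True
        \<comment> \<open>A zero among the first \<open>r\<close> diagonal entries of any block lies
          in \<open>csv_set r Ss\<close>, where f(0) = 0 is assumed.\<close>
        then have "csv Ss i j = 0 \<Longrightarrow> f 0 = 0" using f_zero in_csv [OF i True] by simp
        then show ?thesis using True is_tsvd_blocks(3) [OF tsvd i j] by (cases "csv Ss i j = 0") auto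
      next
        case False
        then show ?thesis using is_tcsvd_csv_eq_0 [OF tcsvd i _ j] by simp
      qed
    qed
    also have "\<dots> = ?T (\<lambda>i j. f (?c i j))"
      using r by (intro svd_tensor_extend [symmetric]) simp
    also have "\<dots> = E *\<^sub>t ?T' (\<lambda>i j. f (?c i j)) *\<^sub>t E" by (rule sandwich [symmetric])
    also have "?T' (\<lambda>i j. f (?c i j)) = 1 / ?k \<cdot>\<^sub>t
        t_contour_integral_family n m p \<Gamma> (csv_set r Ss) (\<lambda>z. f z \<cdot>\<^sub>t tpinv (z \<cdot>\<^sub>t E -\<^sub>t A))"
      by (rule family [symmetric]) (rule f_analytic)
    finally show ?thesis .
  qed
  \<comment> \<open>No factor \<open>E\<close> appears, because \<open>tpinv A\<close> and the
    integral already have the same form \<open>?T'\<close>, with coefficients 1/c.\<close>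
  have part3: "tpinv A = 1 / ?k \<cdot>\<^sub>t
      t_contour_integral_family n m p \<Gamma> (csv_set r Ss) (\<lambda>z. 1 / z \<cdot>\<^sub>t tpinv (z \<cdot>\<^sub>t E -\<^sub>t A))"
    if "\<And>\<gamma>. \<gamma> \<in> csv_set r Ss \<Longrightarrow> (\<lambda>z. 1 / z) analytic_on on_and_inside (\<Gamma> \<gamma>)"
  proof -
    have "tpinv A = ?T' (\<lambda>i j. inverse (?c i j))"
      using tpinv_svd_tensor [where g = ?c, OF p r unit] unfolding A_eq by simp
    also have "\<dots> = ?T' (\<lambda>i j. 1 / ?c i j)" by (simp add: divide_inverse)
    also have "\<dots> = 1 / ?k \<cdot>\<^sub>t
        t_contour_integral_family n m p \<Gamma> (csv_set r Ss) (\<lambda>z. 1 / z \<cdot>\<^sub>t tpinv (z \<cdot>\<^sub>t E -\<^sub>t A))"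
      by (rule family [symmetric]) (rule that)
    finally show ?thesis .
  qed
  show ?thesis
    using part1 part2 part3 integral(1) [where h = f] integral(1) [where h = "\<lambda>z. 1 / z"] f_analytic
    by blast
qed

end
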